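(* Let $G$ be a finite group and $N\trianglelefteq G$. Then $$\{c_N^G(u)\mid u\in\Omega(G)^\times\}=\{c_1^{G/N}(v)\mid v\in\Omega(G/N)^\times\}.$$ In particular, $c_N^G(u)=0$ for every $u\in\Omega(G)^\times$ if and only if $c_1^{G/N}(v)=0$ for every $v\in\Omega(G/N)^\times$.
   Context: For a finite group $G$, $\Omega(G)$ is the Burnside ring (Grothendieck ring of finite $G$-sets), with $\mathbb Z$-basis $[G/H]$, $(H)$ running over the conjugacy classes of subgroups of $G$. With $\operatorname{core}_G(H)=\bigcap_{g\in G}gHg^{-1}$, for $x=\sum_{(H)}a_H[G/H]\in\Omega(G)$ and $N\trianglelefteq G$ the $N$-core coefficient is $c_N^G(x)=\sum_{(H):\,\operatorname{core}_G(H)=N}a_H$. The superscript indicates the ambient group; $c_1^{G/N}$ is the core coefficient at the trivial subgroup of $G/N$. *)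

theory Defs
  imports "HOL-Algebra.Group_Action" "HOL-Algebra.Left_Coset" "HOL-Algebra.Ring"
begin

text \<open>
  A \<open>G\<close>-set is a carrier together with a map from \<open>G\<close> to the permutations of that carrier.
\<close>

type_synonym ('a, 'e) gset = "'e set \<times> ('a \<Rightarrow> 'e \<Rightarrow> 'e)"

definition finite_gset :: "('a, 'm) monoid_scheme \<Rightarrow> ('a, 'e) gset \<Rightarrow> bool"
  where "finite_gset G X \<longleftrightarrow> group_action G (fst X) (snd X) \<and> finite (fst X)"

definition gset_iso :: "('a, 'm) monoid_scheme \<Rightarrow> ('a, 'e) gset \<Rightarrow> ('a, 'f) gset \<Rightarrow> bool"
  where "gset_iso G X Y \<longleftrightarrow>
    (\<exists>f. bij_betw f (fst X) (fst Y) \<and>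
         (\<forall>g\<in>carrier G. \<forall>x\<in>fst X. f (snd X g x) = snd Y g (f x)))"

text \<open>
  The restrictions below are needed because the elements of \<^const>\<open>BijGroup\<close> are extensional
  functions.
\<close>

definition gset_sum :: "('a, 'e) gset \<Rightarrow> ('a, 'f) gset \<Rightarrow> ('a, 'e + 'f) gset"
  where "gset_sum X Y =
    (fst X <+> fst Y, \<lambda>g. restrict (map_sum (snd X g) (snd Y g)) (fst X <+> fst Y))"

definition gset_prod :: "('a, 'e) gset \<Rightarrow> ('a, 'f) gset \<Rightarrow> ('a, 'e \<times> 'f) gset"
  where "gset_prod X Y =
    (fst X \<times> fst Y, \<lambda>g. restrict (map_prod (snd X g) (snd Y g)) (fst X \<times> fst Y))"

definition trivial_gset :: "'e set \<Rightarrow> ('a, 'e) gset"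
  where "trivial_gset E = (E, \<lambda>g. \<lambda>x\<in>E. x)"

definition coset_gset :: "('a, 'm) monoid_scheme \<Rightarrow> 'a set \<Rightarrow> ('a, 'a set) gset"
  where "coset_gset G H = (lcosets\<^bsub>G\<^esub> H, \<lambda>g. \<lambda>K\<in>lcosets\<^bsub>G\<^esub> H. g <#\<^bsub>G\<^esub> K)"

text \<open>
  The Grothendieck group of the monoid of isomorphism classes of finite \<open>G\<close>-sets under disjoint
  union: \<open>vdiff_eq G X Y X' Y'\<close> says that the formal differences \<open>X - Y\<close> and \<open>X' - Y'\<close> agree.
  Every finite \<open>G\<close>-set is isomorphic to one carried by a set of natural numbers, so letting the
  auxiliary \<open>Z\<close>, and the representatives in \<open>vclass\<close>, range over these loses nothing.
\<close>

definition vdiff_eq :: "('a, 'm) monoid_scheme \<Rightarrow>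
    ('a, 'e) gset \<Rightarrow> ('a, 'f) gset \<Rightarrow> ('a, 'h) gset \<Rightarrow> ('a, 'k) gset \<Rightarrow> bool"
  where "vdiff_eq G X Y X' Y' \<longleftrightarrow>
    (\<exists>Z :: ('a, nat) gset. finite_gset G Z \<and>
       gset_iso G (gset_sum (gset_sum X Y') Z) (gset_sum (gset_sum X' Y) Z))"

definition vclass :: "('a, 'm) monoid_scheme \<Rightarrow> ('a, 'e) gset \<Rightarrow> ('a, 'f) gset \<Rightarrow>
    (('a, nat) gset \<times> ('a, nat) gset) set"
  where "vclass G X Y =
    {(A, B). finite_gset G A \<and> finite_gset G B \<and> vdiff_eq G A B X Y}"

text \<open>
  \<open>(A - B) (C - D) = (A C + B D) - (A D + B C)\<close>; the unions are over representatives, whose choice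
  is immaterial.
\<close>

definition burnside_ring ::
    "('a, 'm) monoid_scheme \<Rightarrow> (('a, nat) gset \<times> ('a, nat) gset) set ring"
  where "burnside_ring G =
    \<lparr>carrier = {vclass G A B | (A :: ('a, nat) gset) (B :: ('a, nat) gset).
                  finite_gset G A \<and> finite_gset G B},
     mult = (\<lambda>x y. \<Union>(A, B)\<in>x. \<Union>(C, D)\<in>y.
               vclass G (gset_sum (gset_prod A C) (gset_prod B D))
                        (gset_sum (gset_prod A D) (gset_prod B C))),
     one = vclass G (trivial_gset {0 :: nat}) (trivial_gset ({} :: nat set)),
     zero = vclass G (trivial_gset ({} :: nat set)) (trivial_gset ({} :: nat set)),
     add = (\<lambda>x y. \<Union>(A, B)\<in>x. \<Union>(C, D)\<in>y. vclass G (gset_sum A C) (gset_sum B D))\<rparr>"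

definition burnside_coset :: "('a, 'm) monoid_scheme \<Rightarrow> 'a set \<Rightarrow>
    (('a, nat) gset \<times> ('a, nat) gset) set"
  where "burnside_coset G H = vclass G (coset_gset G H) (trivial_gset ({} :: nat set))"

definition conj_class :: "('a, 'm) monoid_scheme \<Rightarrow> 'a set \<Rightarrow> 'a set set"
  where "conj_class G H = {g <#\<^bsub>G\<^esub> H #>\<^bsub>G\<^esub> inv\<^bsub>G\<^esub> g | g. g \<in> carrier G}"

definition subgroup_classes :: "('a, 'm) monoid_scheme \<Rightarrow> 'a set set set"
  where "subgroup_classes G = {conj_class G H | H. subgroup H G}"

definition normal_core :: "('a, 'm) monoid_scheme \<Rightarrow> 'a set \<Rightarrow> 'a set"
  where "normal_core G H = (\<Inter>g\<in>carrier G. g <#\<^bsub>G\<^esub> H #>\<^bsub>G\<^esub> inv\<^bsub>G\<^esub> g)"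

text \<open>
  The coordinates of \<open>x\<close> in the basis \<open>[G/H]\<close>, indexed by conjugacy classes \<open>C\<close> and made unique by
  the value \<open>0\<close> off the index set. Neither the ring element \<open>[G/H]\<close> nor the core of \<open>H\<close>
  changes when \<open>H\<close> is replaced by a conjugate, so any representative of \<open>C\<close> may be used.
\<close>

definition burnside_coeff :: "('a, 'm) monoid_scheme \<Rightarrow>
    (('a, nat) gset \<times> ('a, nat) gset) set \<Rightarrow> 'a set set \<Rightarrow> int"
  where "burnside_coeff G x =
    (THE a. (\<forall>C. C \<notin> subgroup_classes G \<longrightarrow> a C = 0) \<and>
       x = (\<Oplus>\<^bsub>burnside_ring G\<^esub>C\<in>subgroup_classes G.
              [a C] \<cdot>\<^bsub>burnside_ring G\<^esub> burnside_coset G (SOME H. H \<in> C)))"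

definition core_coeff :: "('a, 'm) monoid_scheme \<Rightarrow> 'a set \<Rightarrow>
    (('a, nat) gset \<times> ('a, nat) gset) set \<Rightarrow> int"
  where "core_coeff G N x =
    (\<Sum>C\<in>{C \<in> subgroup_classes G. normal_core G (SOME H. H \<in> C) = N}. burnside_coeff G x C)"

end

theory Submission
  imports Defs
begin

text \<open>
  Taking \<open>N\<close>-fixed points sends \<open>[G/H]\<close> to \<open>[(G/N)/(H/N)]\<close> if \<open>N \<subseteq> H\<close> and to \<open>0\<close> otherwise. A
  subgroup with core \<open>N\<close> contains \<open>N\<close>, and the core of \<open>H/N\<close> is trivial exactly when that of \<open>H\<close>
  is \<open>N\<close>; hence \<open>c\<^sub>N(x) = c\<^sub>1(x\<^sup>N)\<close>. Fixed points and inflation are ring homomorphisms, and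
  inflation is a section of taking fixed points, so units lift. Everything is computed through the
  table of marks \<open>|X\<^sup>K|\<close>, which by Burnside's theorem embeds the Burnside ring into the ring of
  integer functions on the set of subgroups; in terms of marks, fixed points and inflation are just
  restriction along preimage and image of subgroups.
\<close>

section \<open>Finite \<open>G\<close>-sets and their marks\<close>

text \<open>Ring elements are classes of formal differences, and \<open>burnside_coeff\<close> is a
  \<open>THE\<close> over expansions in the ring, so direct calculation with either would mean
  handling isomorphisms at every turn. Marks remove both difficulties: sums, products and inverses
  are decided pointwise, and a coefficient vector is the unique integral solution of a linear system
  that is triangular for subconjugacy. Taking fixed points is needed only as a relation:
  \<open>y\<close> has at \<open>K\<close> the mark that \<open>x\<close> has at the preimage
  \<open>\<Union>K\<close>. The core formula is proved for this relation. It relates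
  \<open>x\<close> to its fixed points, and also the inflation of an element \<open>v\<close> to
  \<open>v\<close> itself, because the image of the preimage of \<open>K\<close> is
  \<open>K\<close>. So one formula serves both inclusions. The subgroups \<open>H/N\<close> coming
  from chosen representatives \<open>H\<close> need not be the representatives chosen in
  \<open>G/N\<close>. Core coefficients are therefore shown to be computable from any finite family
  of coset spaces, repetitions up to conjugacy allowed.\<close>

text \<open>Bijectivity is derived: acting by \<open>inv g\<close> undoes acting by
  \<open>g\<close>. Extensionality turns the pointwise product law into the equation of functions
  that a homomorphism into \<open>BijGroup\<close> requires.\<close>

lemma (in group) finite_gsetI:
  assumes "finite (fst X)"
    and ext: "\<And>g. g \<in> carrier G \<Longrightarrow> snd X g \<in> extensional (fst X)"
    and cl: "\<And>g x. g \<in> carrier G \<Longrightarrow> x \<in> fst X \<Longrightarrow> snd X g x \<in> fst X"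
    and one: "\<And>x. x \<in> fst X \<Longrightarrow> snd X \<one> x = x"
    and mult: "\<And>g h x. g \<in> carrier G \<Longrightarrow> h \<in> carrier G \<Longrightarrow> x \<in> fst X \<Longrightarrow>
      snd X (g \<otimes> h) x = snd X g (snd X h x)"
  shows "finite_gset G X"
proof -
  have bij: "snd X g \<in> Bij (fst X)" if g: "g \<in> carrier G" for g
  proof -
    have "bij_betw (snd X g) (fst X) (fst X)"
      by (rule bij_betw_byWitness[where f'="snd X (inv g)"])
        (use g cl in \<open>auto simp: mult[symmetric] one\<close>)
    then show ?thesis
      using ext g by (simp add: Bij_def)
  qed
  have "snd X (g \<otimes> h) = compose (fst X) (snd X g) (snd X h)"
    if "g \<in> carrier G" "h \<in> carrier G" for g h
  proof (rule extensionalityI[where A = "fst X"])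
    show "snd X (g \<otimes> h) \<in> extensional (fst X)"
      using ext that by blast
  qed (use that mult in \<open>auto simp: compose_def\<close>)
  then have "snd X \<in> hom G (BijGroup (fst X))"
    using bij by (auto simp: hom_def BijGroup_def)
  then have "group_action G (fst X) (snd X)"
    by (simp add: group_action_def group_hom_def group_hom_axioms_def group_BijGroup)
  then show ?thesis
    using assms(1) by (simp add: finite_gset_def)
qed

lemma finite_gset_finite [simp]: "finite_gset G X \<Longrightarrow> finite (fst X)"
  by (simp add: finite_gset_def)

lemma finite_gset_closed [simp]:
  "finite_gset G X \<Longrightarrow> g \<in> carrier G \<Longrightarrow> x \<in> fst X \<Longrightarrow> snd X g x \<in> fst X"
  by (meson finite_gset_def group_action.element_image)

lemma finite_gset_one [simp]:
  "finite_gset G X \<Longrightarrow> x \<in> fst X \<Longrightarrow> snd X \<one>\<^bsub>G\<^esub> x = x"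
  by (metis finite_gset_def group_action.id_eq_one restrict_apply')

lemma finite_gset_mult:
  "finite_gset G X \<Longrightarrow> g \<in> carrier G \<Longrightarrow> h \<in> carrier G \<Longrightarrow> x \<in> fst X \<Longrightarrow>
    snd X (g \<otimes>\<^bsub>G\<^esub> h) x = snd X g (snd X h x)"
  by (meson finite_gset_def group_action.composition_rule)

lemma finite_gset_inv [simp]:
  assumes "finite_gset G X" "g \<in> carrier G" "x \<in> fst X"
  shows "snd X (inv\<^bsub>G\<^esub> g) (snd X g x) = x"
  using assms by (meson finite_gset_def group_action.orbit_sym_aux)

lemma finite_gset_extensional:
  "finite_gset G X \<Longrightarrow> g \<in> carrier G \<Longrightarrow> snd X g \<in> extensional (fst X)"
  by (meson finite_gset_def group_action.bij_prop0 Bij_imp_extensional)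

lemma finite_gset_group: "finite_gset G X \<Longrightarrow> group G"
  by (meson finite_gset_def group_action.group_hom group_hom.axioms(1))

lemma finite_gset_sum:
  assumes X: "finite_gset G X" and Y: "finite_gset G Y"
  shows "finite_gset G (gset_sum X Y)"
  by (rule group.finite_gsetI[OF finite_gset_group[OF X]])
    (use X Y in \<open>auto simp: gset_sum_def finite_gset_mult group.is_monoid finite_gset_group\<close>)

lemma finite_gset_prod:
  assumes X: "finite_gset G X" and Y: "finite_gset G Y"
  shows "finite_gset G (gset_prod X Y)"
  by (rule group.finite_gsetI[OF finite_gset_group[OF X]])
    (use X Y in \<open>auto simp: gset_prod_def finite_gset_mult\<close>)

lemma (in group) finite_gset_trivial: "finite E \<Longrightarrow> finite_gset G (trivial_gset E)"
  by (rule finite_gsetI) (auto simp: trivial_gset_def)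

section \<open>Invariant subsets, orbits and stabilizers\<close>

text \<open>The action is cut down together with the carrier so as to be extensional again. It is an
  action only for invariant \<open>S\<close>, below an orbit or the complement of one.\<close>

definition sub_gset :: "('a, 'e) gset \<Rightarrow> 'e set \<Rightarrow> ('a, 'e) gset"
  where "sub_gset X S = (S, \<lambda>g. restrict (snd X g) S)"

lemma finite_gset_sub_gset:
  assumes X: "finite_gset G X" and "S \<subseteq> fst X"
    and cl: "\<And>g x. g \<in> carrier G \<Longrightarrow> x \<in> S \<Longrightarrow> snd X g x \<in> S"
  shows "finite_gset G (sub_gset X S)"
  by (rule group.finite_gsetI[OF finite_gset_group[OF X]])
    (use assms in \<open>auto simp: sub_gset_def finite_gset_mult subset_iff intro: finite_subset\<close>)

lemma orbit_subset: "finite_gset G X \<Longrightarrow> x \<in> fst X \<Longrightarrow> orbit G (snd X) x \<subseteq> fst X"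
  by (auto simp: orbit_def)

lemma orbit_self: "finite_gset G X \<Longrightarrow> x \<in> fst X \<Longrightarrow> x \<in> orbit G (snd X) x"
  by (meson finite_gset_def group_action.orbit_refl)

lemma orbit_closed:
  assumes X: "finite_gset G X" and x: "x \<in> fst X" and g: "g \<in> carrier G"
    and z: "z \<in> orbit G (snd X) x"
  shows "snd X g z \<in> orbit G (snd X) x"
proof -
  obtain h where "h \<in> carrier G" "z = snd X h x"
    using z by (auto simp: orbit_def)
  moreover have "g \<otimes>\<^bsub>G\<^esub> h \<in> carrier G"
    using calculation g finite_gset_group[OF X] by (simp add: group.is_monoid monoid.m_closed)
  ultimately show ?thesis
    using X x g by (force simp: orbit_def finite_gset_mult)
qed

lemma orbit_compl_closed:
  assumes X: "finite_gset G X" and x: "x \<in> fst X" and g: "g \<in> carrier G"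
    and z: "z \<in> fst X - orbit G (snd X) x"
  shows "snd X g z \<in> fst X - orbit G (snd X) x"
proof -
  have "inv\<^bsub>G\<^esub> g \<in> carrier G"
    using finite_gset_group[OF X] g by simp
  then show ?thesis
    using orbit_closed[OF X x, of "inv\<^bsub>G\<^esub> g" "snd X g z"] X g z by auto
qed

lemma finite_gset_orbit:
  "finite_gset G X \<Longrightarrow> x \<in> fst X \<Longrightarrow> finite_gset G (sub_gset X (orbit G (snd X) x))"
  by (intro finite_gset_sub_gset orbit_subset orbit_closed)

lemma finite_gset_orbit_compl:
  "finite_gset G X \<Longrightarrow> x \<in> fst X \<Longrightarrow> finite_gset G (sub_gset X (fst X - orbit G (snd X) x))"
  by (intro finite_gset_sub_gset orbit_compl_closed) auto

lemma subgroup_stabilizer: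
  "finite_gset G X \<Longrightarrow> x \<in> fst X \<Longrightarrow> subgroup (stabilizer G (snd X) x) G"
  by (meson finite_gset_def group_action.stabilizer_subgroup)

text \<open>Cancelling \<open>h\<close> turns the equation into a statement about one element fixing
  \<open>x\<close>. Coincidences among the points of an orbit thus depend on the stabilizer
  alone.\<close>

lemma gset_action_eq_iff:
  assumes X: "finite_gset G X" and x: "x \<in> fst X" and g: "g \<in> carrier G" and h: "h \<in> carrier G"
  shows "snd X g x = snd X h x \<longleftrightarrow> inv\<^bsub>G\<^esub> h \<otimes>\<^bsub>G\<^esub> g \<in> stabilizer G (snd X) x"
proof -
  interpret group G
    using finite_gset_group[OF X] .
  let ?k = "inv\<^bsub>G\<^esub> h \<otimes>\<^bsub>G\<^esub> g"
  have k: "?k \<in> carrier G" "h \<otimes>\<^bsub>G\<^esub> ?k = g"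
    using g h by (simp_all add: m_assoc[symmetric])
  have "snd X h (snd X ?k x) = snd X g x"
    using finite_gset_mult[OF X h k(1) x] k(2) by simp
  moreover have "snd X ?k x = x \<longleftrightarrow> snd X h (snd X ?k x) = snd X h x"
    using finite_gset_inv[OF X h x] finite_gset_inv[OF X h finite_gset_closed[OF X k(1) x]] by metis
  ultimately show ?thesis
    using g h by (simp add: stabilizer_def)
qed

text \<open>The isomorphism sends \<open>g x\<close> to \<open>g y\<close>. Equal stabilizers mean
  that \<open>g x = h x\<close> and \<open>g y = h y\<close> are equivalent, which gives
  well-definedness in one direction and injectivity in the other.\<close>

lemma transitive_gset_iso:
  assumes X: "finite_gset G X" and Y: "finite_gset G Y" and x: "x \<in> fst X" and y: "y \<in> fst Y"
    and tX: "fst X \<subseteq> orbit G (snd X) x" and tY: "fst Y \<subseteq> orbit G (snd Y) y"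
    and st: "stabilizer G (snd X) x = stabilizer G (snd Y) y"
  shows "gset_iso G X Y"
proof -
  interpret group G
    using finite_gset_group[OF X] .
  define f where "f z = snd Y (SOME g. g \<in> carrier G \<and> snd X g x = z) y" for z
  have eq: "snd X g x = snd X h x \<longleftrightarrow> snd Y g y = snd Y h y"
    if "g \<in> carrier G" "h \<in> carrier G" for g h
    using gset_action_eq_iff[OF X x that] gset_action_eq_iff[OF Y y that] st by simp
  have f: "f (snd X g x) = snd Y g y" if "g \<in> carrier G" for g
  proof -
    have "\<exists>h. h \<in> carrier G \<and> snd X h x = snd X g x"
      using that by blast
    note some = someI_ex[OF this]
    show ?thesis
      unfolding f_def using eq[OF conjunct1[OF some] that] conjunct2[OF some] by blast
  qed
  have X': "\<exists>g\<in>carrier G. z = snd X g x" if "z \<in> fst X" for z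
    using tX that by (auto simp: orbit_def)
  have Y': "\<exists>g\<in>carrier G. z = snd Y g y" if "z \<in> fst Y" for z
    using tY that by (auto simp: orbit_def)
  have "bij_betw f (fst X) (fst Y)"
    unfolding bij_betw_def
  proof (intro conjI inj_onI subset_antisym subsetI)
    show "u = v" if uv: "u \<in> fst X" "v \<in> fst X" "f u = f v" for u v
    proof -
      obtain g h where "g \<in> carrier G" "u = snd X g x" "h \<in> carrier G" "v = snd X h x"
        using X'[OF uv(1)] X'[OF uv(2)] by blast
      then show ?thesis
        using uv(3) f[of g] f[of h] eq[of g h] by simp
    qed
    show "z \<in> fst Y" if z: "z \<in> f ` fst X" for z
    proof -
      obtain u where u: "u \<in> fst X" "z = f u"
        using z by blast
      obtain g where g: "g \<in> carrier G" "u = snd X g x"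
        using X'[OF u(1)] by blast
      show ?thesis
        using f[OF g(1)] g u finite_gset_closed[OF Y g(1) y] by simp
    qed
    show "z \<in> f ` fst X" if z: "z \<in> fst Y" for z
    proof -
      obtain g where g: "g \<in> carrier G" "z = snd Y g y"
        using Y'[OF z] by blast
      show ?thesis
        using f[OF g(1)] g(2) finite_gset_closed[OF X g(1) x] by (metis image_eqI)
    qed
  qed
  moreover have "f (snd X g z) = snd Y g (f z)" if "g \<in> carrier G" "z \<in> fst X" for g z
  proof -
    obtain h where h: "h \<in> carrier G" "z = snd X h x"
      using X' \<open>z \<in> fst X\<close> by blast
    show ?thesis
      using f[OF h(1)] f[of "g \<otimes>\<^bsub>G\<^esub> h"] h that(1)
      by (simp add: finite_gset_mult[OF X that(1) h(1) x] finite_gset_mult[OF Y that(1) h(1) y])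
  qed
  ultimately show ?thesis
    by (auto simp: gset_iso_def)
qed

lemma orbit_gset_iso:
  assumes X: "finite_gset G X" and Y: "finite_gset G Y" and x: "x \<in> fst X" and y: "y \<in> fst Y"
    and tY: "fst Y \<subseteq> orbit G (snd Y) y"
    and st: "stabilizer G (snd X) x = stabilizer G (snd Y) y"
  shows "gset_iso G (sub_gset X (orbit G (snd X) x)) Y"
  using orbit_self[OF X x] st
  by (intro transitive_gset_iso[OF finite_gset_orbit[OF X x] Y _ y _ tY, of x])
    (auto simp: sub_gset_def orbit_def stabilizer_def)

text \<open>Invariance keeps \<open>g x\<close> in the piece of \<open>x\<close>, so that the same
  one of the two isomorphisms applies to both and equivariance survives the case
  distinction.\<close>

lemma gset_iso_glue:
  assumes "S \<subseteq> fst X" "T \<subseteq> fst Y"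
    and cl: "\<And>g x. g \<in> carrier G \<Longrightarrow> x \<in> S \<Longrightarrow> snd X g x \<in> S"
    and cl': "\<And>g x. g \<in> carrier G \<Longrightarrow> x \<in> fst X - S \<Longrightarrow> snd X g x \<in> fst X - S"
    and iso: "gset_iso G (sub_gset X S) (sub_gset Y T)"
    and iso': "gset_iso G (sub_gset X (fst X - S)) (sub_gset Y (fst Y - T))"
  shows "gset_iso G X Y"
proof -
  obtain f where f: "bij_betw f S T" "\<And>g x. g \<in> carrier G \<Longrightarrow> x \<in> S \<Longrightarrow> f (snd X g x) = snd Y g (f x)"
    using iso by (auto simp: gset_iso_def sub_gset_def bij_betw_apply)
  obtain f' where f': "bij_betw f' (fst X - S) (fst Y - T)"
      "\<And>g x. g \<in> carrier G \<Longrightarrow> x \<in> fst X - S \<Longrightarrow> f' (snd X g x) = snd Y g (f' x)"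
    using iso' bij_betw_apply by (fastforce simp: gset_iso_def sub_gset_def)
  let ?h = "\<lambda>x. if x \<in> S then f x else f' x"
  have "bij_betw ?h (S \<union> (fst X - S)) (T \<union> (fst Y - T))"
    by (rule bij_betw_disjoint_Un[OF f(1) f'(1)]) auto
  moreover have "S \<union> (fst X - S) = fst X" "T \<union> (fst Y - T) = fst Y"
    using assms(1,2) by auto
  moreover have "?h (snd X g x) = snd Y g (?h x)" if "g \<in> carrier G" "x \<in> fst X" for g x
    using that f(2) f'(2) cl cl' by auto
  ultimately show ?thesis
    by (auto simp: gset_iso_def)
qed

lemma gset_iso_trans:
  assumes "gset_iso G X Y" "gset_iso G Y Z"
  shows "gset_iso G X Z"
proof -
  obtain f where f: "bij_betw f (fst X) (fst Y)"
    "\<And>g x. g \<in> carrier G \<Longrightarrow> x \<in> fst X \<Longrightarrow> f (snd X g x) = snd Y g (f x)"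
    using assms(1) by (auto simp: gset_iso_def)
  obtain h where h: "bij_betw h (fst Y) (fst Z)"
    "\<And>g x. g \<in> carrier G \<Longrightarrow> x \<in> fst Y \<Longrightarrow> h (snd Y g x) = snd Z g (h x)"
    using assms(2) by (auto simp: gset_iso_def)
  show ?thesis
    unfolding gset_iso_def using bij_betw_trans[OF f(1) h(1)] f h
    by (intro exI[of _ "h \<circ> f"]) (auto simp: bij_betw_apply)
qed

section \<open>Marks and Burnside's theorem\<close>

definition mark :: "('a, 'e) gset \<Rightarrow> 'a set \<Rightarrow> nat"
  where "mark X K = card {x \<in> fst X. \<forall>k\<in>K. snd X k x = x}"

lemma mark_gset_iso:
  assumes X: "finite_gset G X" and iso: "gset_iso G X Y" and K: "K \<subseteq> carrier G"
  shows "mark X K = mark Y K"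
proof -
  obtain f where f: "bij_betw f (fst X) (fst Y)"
    "\<And>g x. g \<in> carrier G \<Longrightarrow> x \<in> fst X \<Longrightarrow> f (snd X g x) = snd Y g (f x)"
    using iso by (auto simp: gset_iso_def)
  have eq: "snd Y k (f x) = f x \<longleftrightarrow> snd X k x = x" if "k \<in> K" "x \<in> fst X" for k x
    using f X K that
    by (metis bij_betw_imp_inj_on finite_gset_closed inj_on_eq_iff subsetD)
  have "bij_betw f {x \<in> fst X. \<forall>k\<in>K. snd X k x = x} {y \<in> fst Y. \<forall>k\<in>K. snd Y k y = y}"
  proof (rule bij_betw_subset[OF f(1)])
    show "f ` {x \<in> fst X. \<forall>k\<in>K. snd X k x = x} = {y \<in> fst Y. \<forall>k\<in>K. snd Y k y = y}"
      unfolding bij_betw_imp_surj_on[OF f(1), symmetric] using eq by blast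
  qed auto
  then show ?thesis
    by (simp add: mark_def bij_betw_same_card)
qed

lemma mark_gset_sum:
  assumes X: "finite (fst X)" and Y: "finite (fst Y)"
  shows "mark (gset_sum X Y) K = mark X K + mark Y K"
proof -
  have "{z \<in> fst (gset_sum X Y). \<forall>k\<in>K. snd (gset_sum X Y) k z = z} =
      {x \<in> fst X. \<forall>k\<in>K. snd X k x = x} <+> {y \<in> fst Y. \<forall>k\<in>K. snd Y k y = y}"
    by (auto simp: gset_sum_def)
  then show ?thesis
    using X Y by (simp add: mark_def card_Plus)
qed

lemma mark_gset_prod: "mark (gset_prod X Y) K = mark X K * mark Y K"
proof -
  have "{z \<in> fst (gset_prod X Y). \<forall>k\<in>K. snd (gset_prod X Y) k z = z} =
      {x \<in> fst X. \<forall>k\<in>K. snd X k x = x} \<times> {y \<in> fst Y. \<forall>k\<in>K. snd Y k y = y}"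
    by (auto simp: gset_prod_def)
  then show ?thesis
    by (simp add: mark_def card_cartesian_product)
qed

lemma mark_trivial_gset: "mark (trivial_gset E) K = card E"
  by (simp add: mark_def trivial_gset_def)

lemma mark_split:
  assumes "finite (fst X)" "S \<subseteq> fst X"
  shows "mark X K = mark (sub_gset X S) K + mark (sub_gset X (fst X - S)) K"
proof -
  have "{x \<in> fst X. \<forall>k\<in>K. snd X k x = x} =
      {x \<in> fst (sub_gset X S). \<forall>k\<in>K. snd (sub_gset X S) k x = x} \<union>
      {x \<in> fst (sub_gset X (fst X - S)). \<forall>k\<in>K. snd (sub_gset X (fst X - S)) k x = x}"
    using assms(2) by (auto simp: sub_gset_def)
  then show ?thesis
    unfolding mark_def using assms
    by (subst card_Un_disjoint[symmetric]) (auto simp: sub_gset_def intro: finite_subset)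
qed

lemma mark_pos_iff:
  assumes X: "finite_gset G X" and K: "K \<subseteq> carrier G"
  shows "mark X K > 0 \<longleftrightarrow> (\<exists>x\<in>fst X. K \<subseteq> stabilizer G (snd X) x)"
  using X K by (auto simp: mark_def card_gt_0_iff stabilizer_def)

text \<open>
  Burnside's theorem. A subgroup of maximal order with nonzero mark is a stabilizer in both
  \<open>X\<close> and \<open>Y\<close>, so an orbit can be split off from each of them.
\<close>

lemma gset_iso_if_marks_eq:
  assumes "finite_gset G X" "finite_gset G Y" "finite (carrier G)"
    and "\<And>K. subgroup K G \<Longrightarrow> mark X K = mark Y K"
  shows "gset_iso G X Y"
  using assms
proof (induction "card (fst X)" arbitrary: X Y rule: less_induct)
  case less
  note X = less.prems(1) and Y = less.prems(2) and fin = less.prems(3) and eq = less.prems(4)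
  interpret group G
    using finite_gset_group[OF X] .
  \<comment> \<open>The trivial subgroup fixes every point, so its mark is the size of the
    set.\<close>
  have card_eq: "card (fst X) = card (fst Y)"
    using eq[OF triv_subgroup] X Y by (simp add: mark_def cong: conj_cong)
  show ?case
  proof (cases "fst X = {}")
    case True
    then have "fst Y = {}"
      using card_eq Y by (metis card_0_eq card.empty finite_gset_finite)
    then show ?thesis
      using True by (auto simp: gset_iso_def bij_betw_def)
  next
    case False
    obtain x where x: "x \<in> fst X"
      and max: "\<And>z. z \<in> fst X \<Longrightarrow> card (stabilizer G (snd X) z) \<le> card (stabilizer G (snd X) x)"
      using obtains_MAX[OF finite_gset_finite[OF X] False, of "\<lambda>z. card (stabilizer G (snd X) z)"]
        finite_gset_finite[OF X] by (metis Max_ge finite_imageI imageI)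
    define H where "H = stabilizer G (snd X) x"
    have H: "subgroup H G"
      using subgroup_stabilizer[OF X x] by (simp add: H_def)
    have "mark Y H > 0"
      using eq[OF H] mark_pos_iff[OF X subgroup.subset[OF H]] x H_def by auto
    then obtain y where y: "y \<in> fst Y" and Hy: "H \<subseteq> stabilizer G (snd Y) y"
      using mark_pos_iff[OF Y subgroup.subset[OF H]] by auto
    \<comment> \<open>Going back from \<open>Y\<close> to \<open>X\<close> gives a chain from
      \<open>H\<close> through the stabilizer of \<open>y\<close> to that of some \<open>z\<close>
      in \<open>X\<close>; maximality of \<open>H\<close> collapses it.\<close>
    have "mark X (stabilizer G (snd Y) y) > 0"
      using eq[OF subgroup_stabilizer[OF Y y]] y
        mark_pos_iff[OF Y subgroup.subset[OF subgroup_stabilizer[OF Y y]]] by auto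
    then obtain z where z: "z \<in> fst X" "stabilizer G (snd Y) y \<subseteq> stabilizer G (snd X) z"
      using mark_pos_iff[OF X subgroup.subset[OF subgroup_stabilizer[OF Y y]]] by auto
    have "card (stabilizer G (snd Y) y) \<le> card H"
      using card_mono[OF _ z(2)] max[OF z(1)] fin by (fastforce simp: H_def stabilizer_def)
    then have st: "H = stabilizer G (snd Y) y"
      using Hy fin by (intro card_seteq) (auto simp: stabilizer_def)
    let ?O = "orbit G (snd X) x" and ?P = "orbit G (snd Y) y"
    have iso: "gset_iso G (sub_gset X ?O) (sub_gset Y ?P)"
    proof (rule orbit_gset_iso[OF X finite_gset_orbit[OF Y y] x])
      show "y \<in> fst (sub_gset Y ?P)"
        using orbit_self[OF Y y] by (simp add: sub_gset_def)
    qed (use st orbit_self[OF Y y] in \<open>auto simp: H_def sub_gset_def orbit_def stabilizer_def\<close>)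
    have "gset_iso G (sub_gset X (fst X - ?O)) (sub_gset Y (fst Y - ?P))"
    proof (rule less.hyps[OF _ finite_gset_orbit_compl[OF X x] finite_gset_orbit_compl[OF Y y] fin])
      have "fst X - ?O \<subset> fst X"
        using x orbit_self[OF X x] by auto
      then show "card (fst (sub_gset X (fst X - ?O))) < card (fst X)"
        using X by (simp add: sub_gset_def psubset_card_mono)
    next
      fix K assume K: "subgroup K G"
      \<comment> \<open>The two orbits contribute equally, so subtracting them leaves equal marks on
        the complements, as the induction hypothesis demands.\<close>
      have "mark (sub_gset X ?O) K = mark (sub_gset Y ?P) K"
        using mark_gset_iso[OF finite_gset_orbit[OF X x] iso] K by (simp add: subgroup.subset)
      then show "mark (sub_gset X (fst X - ?O)) K = mark (sub_gset Y (fst Y - ?P)) K"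
        using eq[OF K] mark_split[of X ?O K] mark_split[of Y ?P K] X Y x y
        by (simp add: orbit_subset)
    qed
    then show ?thesis
      using gset_iso_glue[OF orbit_subset[OF X x] orbit_subset[OF Y y] _ _ iso]
        orbit_closed[OF X x] orbit_compl_closed[OF X x] by blast
  qed
qed

section \<open>Coset spaces\<close>

lemma (in group) coset_gset_act:
  assumes H: "subgroup H G" and "g \<in> carrier G" "a \<in> carrier G"
  shows "snd (coset_gset G H) g (a <# H) = (g \<otimes> a) <# H"
  using assms lcos_m_assoc[OF subgroup.subset[OF H]] by (auto simp: coset_gset_def LCOSETS_def)

lemma (in group) coset_gset_base:
  assumes H: "subgroup H G"
  shows "H \<in> fst (coset_gset G H)"
    and "g \<in> carrier G \<Longrightarrow> snd (coset_gset G H) g H = g <# H"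
    and "fst (coset_gset G H) = (\<lambda>a. a <# H) ` carrier G"
proof -
  have one: "\<one> <# H = H"
    by (rule lcos_mult_one[OF subgroup.subset[OF H]])
  then show H': "H \<in> fst (coset_gset G H)"
    by (force simp: coset_gset_def LCOSETS_def)
  show "g \<in> carrier G \<Longrightarrow> snd (coset_gset G H) g H = g <# H"
    using H' by (simp add: coset_gset_def)
  show "fst (coset_gset G H) = (\<lambda>a. a <# H) ` carrier G"
    by (auto simp: coset_gset_def LCOSETS_def)
qed

lemma (in group) finite_gset_coset:
  assumes fin: "finite (carrier G)" and H: "subgroup H G"
  shows "finite_gset G (coset_gset G H)"
proof (rule finite_gsetI)
  show "snd (coset_gset G H) g \<in> extensional (fst (coset_gset G H))" for g
    by (simp add: coset_gset_def)
qed (use fin H in \<open>auto simp: coset_gset_base(3) coset_gset_act m_assoc\<close>)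

lemma (in group) coset_gset_transitive:
  assumes H: "subgroup H G"
  shows "fst (coset_gset G H) \<subseteq> orbit G (snd (coset_gset G H)) H"
  unfolding orbit_def coset_gset_base(3)[OF H]
  using coset_gset_base(2)[OF H, symmetric] by blast

lemma (in group) l_coset_eq_self_iff:
  "subgroup H G \<Longrightarrow> g \<in> carrier G \<Longrightarrow> g <# H = H \<longleftrightarrow> g \<in> H"
  using lcos_self coset_join3 by metis

lemma (in group) stabilizer_coset_gset_base:
  assumes H: "subgroup H G"
  shows "stabilizer G (snd (coset_gset G H)) H = H"
  using subgroup.subset[OF H]
  by (auto simp: stabilizer_def coset_gset_base(2)[OF H] l_coset_eq_self_iff[OF H] cong: conj_cong)

section \<open>Conjugate subgroups as stabilizers of cosets\<close>

text \<open>The bracketing on the right is the one that \<open>gset_action_eq_iff\<close> yields for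
  the elements \<open>g \<otimes> a\<close> and \<open>a\<close>, so stabilizers of cosets can be
  read off from it.\<close>

lemma (in group) mem_conj_iff:
  assumes "H \<subseteq> carrier G" "a \<in> carrier G" "g \<in> carrier G"
  shows "g \<in> a <# H #> inv a \<longleftrightarrow> inv a \<otimes> (g \<otimes> a) \<in> H"
proof
  assume "g \<in> a <# H #> inv a"
  then obtain h where h: "h \<in> H" "g = a \<otimes> h \<otimes> inv a"
    by (auto simp: l_coset_def r_coset_def)
  then have "h \<in> carrier G"
    using assms by blast
  then have "inv a \<otimes> (g \<otimes> a) = h"
    using h assms by (simp add: m_assoc) (simp add: m_assoc[symmetric])
  then show "inv a \<otimes> (g \<otimes> a) \<in> H"
    using h by simp
next
  assume *: "inv a \<otimes> (g \<otimes> a) \<in> H"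
  have "g = a \<otimes> (inv a \<otimes> (g \<otimes> a)) \<otimes> inv a"
    using assms by (simp add: m_assoc) (simp add: m_assoc[symmetric])
  then show "g \<in> a <# H #> inv a"
    using * by (auto simp: l_coset_def r_coset_def)
qed

lemma (in group) conj_subset_carrier:
  "H \<subseteq> carrier G \<Longrightarrow> a \<in> carrier G \<Longrightarrow> a <# H #> inv a \<subseteq> carrier G"
  by (simp add: l_coset_subset_G r_coset_subset_G)

lemma (in group) stabilizer_coset_gset:
  assumes fin: "finite (carrier G)" and H: "subgroup H G" and a: "a \<in> carrier G"
  shows "stabilizer G (snd (coset_gset G H)) (a <# H) = a <# H #> inv a"
proof -
  have "snd (coset_gset G H) g (a <# H) = a <# H \<longleftrightarrow> g \<in> a <# H #> inv a"
    if g: "g \<in> carrier G" for g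
    using gset_action_eq_iff[OF finite_gset_coset[OF fin H] coset_gset_base(1)[OF H] m_closed[OF g a] a]
    unfolding coset_gset_act[OF H g a] stabilizer_coset_gset_base[OF H]
      coset_gset_base(2)[OF H a] coset_gset_base(2)[OF H m_closed[OF g a]]
      mem_conj_iff[OF subgroup.subset[OF H] a g] .
  then show ?thesis
    using conj_subset_carrier[OF subgroup.subset[OF H] a] unfolding stabilizer_def by blast
qed

text \<open>The coset \<open>a H\<close> has stabilizer \<open>a H a^-1\<close>. Through this, facts
  about conjugation follow from isomorphisms of \<open>G\<close>-sets.\<close>

lemma (in group) conj_class_eq_stabilizers:
  assumes "finite (carrier G)" "subgroup H G"
  shows "conj_class G H = stabilizer G (snd (coset_gset G H)) ` fst (coset_gset G H)"
  using stabilizer_coset_gset[OF assms]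
  by (auto simp: conj_class_def coset_gset_base(3)[OF assms(2)] image_image)

lemma normal_core_eq_Inter: "normal_core G H = \<Inter>(conj_class G H)"
  by (auto simp: normal_core_def conj_class_def)

text \<open>Orbit-stabilizer theorem: the base coset of \<open>G/H\<close> has stabilizer
  \<open>H\<close>, so base points with equal stabilizers are available on both sides.\<close>

lemma (in group) coset_gset_iso:
  assumes fin: "finite (carrier G)" and X: "finite_gset G X" and x: "x \<in> fst X"
    and t: "fst X \<subseteq> orbit G (snd X) x"
  shows "gset_iso G X (coset_gset G (stabilizer G (snd X) x))"
  by (rule transitive_gset_iso[OF X finite_gset_coset[OF fin] x,
        of _ "stabilizer G (snd X) x"])
    (use subgroup_stabilizer[OF X x] t in
      \<open>simp_all add: coset_gset_base(1) coset_gset_transitive stabilizer_coset_gset_base\<close>)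

lemma stabilizers_gset_iso:
  assumes X: "finite_gset G X" and iso: "gset_iso G X Y"
  shows "stabilizer G (snd X) ` fst X = stabilizer G (snd Y) ` fst Y"
proof -
  obtain f where f: "bij_betw f (fst X) (fst Y)"
    "\<And>g x. g \<in> carrier G \<Longrightarrow> x \<in> fst X \<Longrightarrow> f (snd X g x) = snd Y g (f x)"
    using iso by (auto simp: gset_iso_def)
  have "snd Y g (f x) = f x \<longleftrightarrow> snd X g x = x" if "g \<in> carrier G" "x \<in> fst X" for g x
    using f X that by (metis bij_betw_imp_inj_on finite_gset_closed inj_on_eq_iff)
  then have "stabilizer G (snd Y) (f x) = stabilizer G (snd X) x" if "x \<in> fst X" for x
    using that by (auto simp: stabilizer_def)
  then show ?thesis
    unfolding bij_betw_imp_surj_on[OF f(1), symmetric] by (auto simp: image_image)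
qed

lemma (in group) conj_class_subgroup:
  assumes "finite (carrier G)" "subgroup H G" "K \<in> conj_class G H"
  shows "subgroup K G"
  using assms subgroup_stabilizer[OF finite_gset_coset] by (auto simp: conj_class_eq_stabilizers)

lemma (in group) conj_class_self:
  assumes H: "subgroup H G"
  shows "H \<in> conj_class G H"
proof -
  have "H = \<one> <# H #> inv \<one>"
    using subgroup.subset[OF H] by (simp add: lcos_mult_one)
  then show ?thesis
    unfolding conj_class_def by blast
qed

text \<open>\<open>G/H\<close> may be based at \<open>a H\<close> instead of \<open>H\<close>. The
  stabilizer there is the conjugate \<open>K\<close>, and the orbit-stabilizer theorem at that point
  gives \<open>G/K\<close>.\<close>

lemma (in group) coset_gset_conj_iso:
  assumes fin: "finite (carrier G)" and H: "subgroup H G" and K: "K \<in> conj_class G H"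
  shows "gset_iso G (coset_gset G H) (coset_gset G K)"
proof -
  obtain a where a: "a \<in> carrier G" and K_eq: "K = a <# H #> inv a"
    using K by (auto simp: conj_class_def)
  let ?X = "coset_gset G H"
  have "g <# H \<in> orbit G (snd ?X) (a <# H)" if g: "g \<in> carrier G" for g
  proof -
    have "g <# H = snd ?X (g \<otimes> inv a) (a <# H)"
      using g a by (simp add: coset_gset_act[OF H] m_assoc)
    moreover have "g \<otimes> inv a \<in> carrier G"
      using g a by simp
    ultimately show ?thesis
      unfolding orbit_def by blast
  qed
  then have t: "fst ?X \<subseteq> orbit G (snd ?X) (a <# H)"
    by (auto simp: coset_gset_base(3)[OF H])
  have "a <# H \<in> fst ?X"
    using a by (simp add: coset_gset_base(3)[OF H])
  from coset_gset_iso[OF fin finite_gset_coset[OF fin H] this t]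
  show ?thesis
    by (simp add: stabilizer_coset_gset[OF fin H a] K_eq)
qed

text \<open>Both classes are the sets of stabilizers of isomorphic \<open>G\<close>-sets. This makes
  the class independent of the representative picked by \<open>SOME\<close>.\<close>

lemma (in group) conj_class_eq:
  assumes fin: "finite (carrier G)" and H: "subgroup H G" and K: "K \<in> conj_class G H"
  shows "conj_class G K = conj_class G H"
  unfolding conj_class_eq_stabilizers[OF fin H]
    conj_class_eq_stabilizers[OF fin conj_class_subgroup[OF fin H K]]
  using stabilizers_gset_iso[OF finite_gset_coset[OF fin H] coset_gset_conj_iso[OF fin H K]] by simp

lemma (in group) subgroup_classes_some:
  assumes fin: "finite (carrier G)" and C: "C \<in> subgroup_classes G"
  shows "subgroup (SOME H. H \<in> C) G" and "conj_class G (SOME H. H \<in> C) = C"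
proof -
  obtain H where H: "subgroup H G" "C = conj_class G H"
    using C by (auto simp: subgroup_classes_def)
  then have "(SOME H. H \<in> C) \<in> conj_class G H"
    using someI[of "\<lambda>K. K \<in> conj_class G H", OF conj_class_self[OF H(1)]] by simp
  then show "subgroup (SOME H. H \<in> C) G" "conj_class G (SOME H. H \<in> C) = C"
    using conj_class_subgroup[OF fin H(1)] conj_class_eq[OF fin H(1)] H(2) by auto
qed

lemma finite_subgroup_classes:
  assumes "finite (carrier G)"
  shows "finite (subgroup_classes G)"
proof -
  have "subgroup_classes G = conj_class G ` {H. subgroup H G}"
    by (auto simp: subgroup_classes_def)
  moreover have "{H. subgroup H G} \<subseteq> Pow (carrier G)"
    using subgroup.subset by blast
  ultimately show ?thesis
    using assms by (metis finite_Pow_iff finite_imageI finite_subset)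
qed

lemma (in group) card_conj_class:
  assumes "H \<subseteq> carrier G" "K \<in> conj_class G H"
  shows "card K = card H"
proof -
  obtain a where a: "a \<in> carrier G" and K: "K = a <# H #> inv a"
    using assms by (auto simp: conj_class_def)
  have "K = (\<lambda>h. a \<otimes> h \<otimes> inv a) ` H"
    by (auto simp: K l_coset_def r_coset_def)
  moreover have "inj_on (\<lambda>h. a \<otimes> h \<otimes> inv a) H"
    using assms(1) a by (auto simp: inj_on_def subset_iff)
  ultimately show ?thesis
    by (simp add: card_image)
qed

section \<open>The coset spaces as a basis\<close>

text \<open>Triangularity of the table of marks: a nonzero entry forces \<open>K\<close> to be
  subconjugate to \<open>H\<close>, while the diagonal entries are positive.\<close>

lemma (in group) mark_coset_gset_pos_iff:
  assumes "finite (carrier G)" "subgroup H G" "K \<subseteq> carrier G"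
  shows "mark (coset_gset G H) K > 0 \<longleftrightarrow> (\<exists>L\<in>conj_class G H. K \<subseteq> L)"
  using mark_pos_iff[OF finite_gset_coset assms(3)] assms by (simp add: conj_class_eq_stabilizers)

text \<open>Evaluate at a representative of maximal order among the classes with \<open>a C \<noteq> 0\<close>.\<close>

lemma (in group) marks_independent:
  fixes a :: "'a set set \<Rightarrow> int"
  assumes fin: "finite (carrier G)"
    and zero: "\<And>K. subgroup K G \<Longrightarrow>
      (\<Sum>C\<in>subgroup_classes G. a C * int (mark (coset_gset G (SOME H. H \<in> C)) K)) = 0"
    and "C \<in> subgroup_classes G"
  shows "a C = 0"
proof (rule ccontr)
  assume "a C \<noteq> 0"
  define R :: "'a set set \<Rightarrow> 'a set" where "R C = (SOME H. H \<in> C)" for C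
  note R = subgroup_classes_some[OF fin, folded R_def]
  let ?A = "{C \<in> subgroup_classes G. a C \<noteq> 0}"
  have "finite ?A" "?A \<noteq> {}"
    using finite_subgroup_classes[OF fin] \<open>a C \<noteq> 0\<close> assms(3) by auto
  then obtain M where M: "M \<in> ?A" and max: "\<And>D. D \<in> ?A \<Longrightarrow> card (R D) \<le> card (R M)"
    using obtains_MAX[of ?A "\<lambda>C. card (R C)"] by (metis (no_types, lifting) Max_ge finite_imageI imageI)
  have M': "M \<in> subgroup_classes G" "a M \<noteq> 0"
    using M by auto
  \<comment> \<open>A nonzero term would put \<open>R M\<close> inside a conjugate \<open>L\<close>
    of \<open>R D\<close>. Since \<open>L\<close> is no larger than \<open>R M\<close>, they
    coincide, and then \<open>D\<close> equals \<open>M\<close>.\<close>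
  have "a D * int (mark (coset_gset G (R D)) (R M)) = 0"
    if D: "D \<in> subgroup_classes G" "D \<noteq> M" for D
  proof (rule ccontr)
    assume *: "a D * int (mark (coset_gset G (R D)) (R M)) \<noteq> 0"
    then obtain L where L: "L \<in> conj_class G (R D)" "R M \<subseteq> L"
      using mark_coset_gset_pos_iff[OF fin R(1)[OF D(1)] subgroup.subset[OF R(1)[OF M'(1)]]] by auto
    have "finite L"
      using conj_class_subgroup[OF fin R(1)[OF D(1)] L(1)] fin by (meson finite_subset subgroup.subset)
    moreover have "card L \<le> card (R M)"
      using card_conj_class[OF subgroup.subset[OF R(1)[OF D(1)]] L(1)] max[of D] D * by simp
    ultimately have "R M = L"
      using L(2) by (simp add: card_seteq)
    then have "conj_class G (R M) = conj_class G (R D)"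
      using conj_class_eq[OF fin R(1)[OF D(1)]] L(1) by simp
    then show False
      using R(2) D M' by simp
  qed
  then have "(\<Sum>C\<in>subgroup_classes G - {M}. a C * int (mark (coset_gset G (R C)) (R M))) = 0"
    by (intro sum.neutral) blast
  then have "(\<Sum>C\<in>subgroup_classes G. a C * int (mark (coset_gset G (R C)) (R M))) =
      a M * int (mark (coset_gset G (R M)) (R M))"
    by (simp add: sum.remove[OF finite_subgroup_classes[OF fin] M'(1)])
  moreover have "mark (coset_gset G (R M)) (R M) > 0"
    using mark_coset_gset_pos_iff[OF fin R(1)[OF M'(1)] subgroup.subset[OF R(1)[OF M'(1)]]]
      conj_class_self[OF R(1)[OF M'(1)]] by blast
  ultimately show False
    using zero[OF R(1)[OF M'(1)]] M'(2) by (simp add: R_def)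
qed

text \<open>Induction on the size: splitting off one orbit, which is a coset space of its
  stabilizer, raises the coefficient at the class of that stabilizer by one.\<close>

lemma (in group) mark_decomposition:
  assumes fin: "finite (carrier G)" and X: "finite_gset G X"
  shows "\<exists>a :: 'a set set \<Rightarrow> int. \<forall>K. subgroup K G \<longrightarrow>
    int (mark X K) = (\<Sum>C\<in>subgroup_classes G. a C * int (mark (coset_gset G (SOME H. H \<in> C)) K))"
  using X
proof (induction "card (fst X)" arbitrary: X rule: less_induct)
  case less
  note X = less.prems
  show ?case
  proof (cases "fst X = {}")
    case True
    then show ?thesis
      by (intro exI[of _ "\<lambda>_. 0"]) (simp add: mark_def)
  next
    case False
    then obtain x where x: "x \<in> fst X"
      by blast
    let ?O = "orbit G (snd X) x" and ?H = "stabilizer G (snd X) x"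
    let ?C = "conj_class G ?H"
    note H = subgroup_stabilizer[OF X x]
    have C: "?C \<in> subgroup_classes G"
      using H by (auto simp: subgroup_classes_def)
    have "fst X - ?O \<subset> fst X"
      using x orbit_self[OF X x] by auto
    then have "card (fst (sub_gset X (fst X - ?O))) < card (fst X)"
      using X by (simp add: sub_gset_def psubset_card_mono)
    from less.hyps[OF this finite_gset_orbit_compl[OF X x]]
    obtain a :: "'a set set \<Rightarrow> int" where a: "\<And>K. subgroup K G \<Longrightarrow>
        int (mark (sub_gset X (fst X - ?O)) K) =
        (\<Sum>C\<in>subgroup_classes G. a C * int (mark (coset_gset G (SOME H. H \<in> C)) K))"
      by blast
    have O: "mark (sub_gset X ?O) K = mark (coset_gset G (SOME H. H \<in> ?C)) K" if K: "subgroup K G" for K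
    proof -
      have "gset_iso G (sub_gset X ?O) (coset_gset G ?H)"
        by (rule orbit_gset_iso[OF X finite_gset_coset[OF fin H] x coset_gset_base(1)[OF H]])
          (simp_all add: coset_gset_transitive[OF H] stabilizer_coset_gset_base[OF H])
      moreover have "gset_iso G (coset_gset G ?H) (coset_gset G (SOME H. H \<in> ?C))"
        by (rule coset_gset_conj_iso[OF fin H]) (rule someI[of "\<lambda>K. K \<in> ?C", OF conj_class_self[OF H]])
      ultimately show ?thesis
        using mark_gset_iso[OF finite_gset_orbit[OF X x] gset_iso_trans subgroup.subset[OF K]] by blast
    qed
    have "int (mark X K) = (\<Sum>C\<in>subgroup_classes G.
        (a C + (if C = ?C then 1 else 0)) * int (mark (coset_gset G (SOME H. H \<in> C)) K))"
      if K: "subgroup K G" for K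
    proof -
      have "int (mark X K) = int (mark (sub_gset X (fst X - ?O)) K) + int (mark (sub_gset X ?O) K)"
        using mark_split[OF finite_gset_finite[OF X] orbit_subset[OF X x]] by simp
      then show ?thesis
        using finite_subgroup_classes[OF fin] C
        by (simp add: a[OF K] O[OF K] distrib_right sum.distrib if_distrib[of "\<lambda>t. t * _"] cong: if_cong)
    qed
    then show ?thesis
      by (intro exI[of _ "\<lambda>C. a C + (if C = ?C then 1 else 0)"]) blast
  qed
qed

section \<open>Inflation and fixed points\<close>

definition inflate :: "('a, 'm) monoid_scheme \<Rightarrow> 'a set \<Rightarrow> ('a set, 'e) gset \<Rightarrow> ('a, 'e) gset"
  where "inflate G N X = (fst X, \<lambda>g. snd X (N #>\<^bsub>G\<^esub> g))"

lemma r_coset_in_FactGroup: "g \<in> carrier G \<Longrightarrow> N #>\<^bsub>G\<^esub> g \<in> carrier (G Mod N)"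
  by (simp add: carrier_FactGroup)

lemma finite_gset_inflate:
  fixes G (structure)
  assumes N: "N \<lhd> G" and X: "finite_gset (G Mod N) X"
  shows "finite_gset G (inflate G N X)"
proof -
  interpret normal N G
    by (rule N)
  show ?thesis
  proof (rule finite_gsetI)
    fix g h x
    assume gh: "g \<in> carrier G" "h \<in> carrier G" and x: "x \<in> fst (inflate G N X)"
    have x': "x \<in> fst X"
      using x by (simp add: inflate_def)
    have "N #> (g \<otimes> h) = (N #> g) \<otimes>\<^bsub>G Mod N\<^esub> (N #> h)"
      using gh by (simp add: rcos_sum)
    then show "snd (inflate G N X) (g \<otimes> h) x = snd (inflate G N X) g (snd (inflate G N X) h x)"
      using finite_gset_mult[OF X r_coset_in_FactGroup[OF gh(1)] r_coset_in_FactGroup[OF gh(2)] x']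
      by (simp add: inflate_def)
  next
    show "snd (inflate G N X) \<one> x = x" if "x \<in> fst (inflate G N X)" for x
      using that finite_gset_one[OF X, of x] subset by (simp add: inflate_def)
  next
    fix g assume "g \<in> carrier G"
    then have g: "N #> g \<in> carrier (G Mod N)"
      by (rule r_coset_in_FactGroup)
    show "snd (inflate G N X) g \<in> extensional (fst (inflate G N X))"
      using finite_gset_extensional[OF X g] by (simp add: inflate_def)
    show "snd (inflate G N X) g x \<in> fst (inflate G N X)" if "x \<in> fst (inflate G N X)" for x
      using finite_gset_closed[OF X g] that by (simp add: inflate_def)
  qed (use finite_gset_finite[OF X] in \<open>simp add: inflate_def\<close>)
qed

lemma mark_inflate: "mark (inflate G N X) K = mark X ((\<lambda>g. N #>\<^bsub>G\<^esub> g) ` K)"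
  by (simp add: mark_def inflate_def)

lemma stabilizer_inflate:
  "stabilizer G (snd (inflate G N X)) x =
    {g \<in> carrier G. N #>\<^bsub>G\<^esub> g \<in> stabilizer (G Mod N) (snd X) x}"
  by (auto simp: stabilizer_def inflate_def r_coset_in_FactGroup)

section \<open>Subgroups of the quotient and their preimages\<close>

text \<open>Elements of \<open>G Mod N\<close> are themselves subsets of \<open>G\<close>, so
  \<open>\<Union>K\<close> is the preimage of \<open>K\<close> under the quotient map, and the
  identity expresses surjectivity. It is what makes inflation a section of taking fixed points on
  the level of marks.\<close>

lemma FactGroup_image_Union:
  fixes G (structure)
  assumes N: "N \<lhd> G" and K: "K \<subseteq> carrier (G Mod N)"
  shows "(\<lambda>g. N #>\<^bsub>G\<^esub> g) ` \<Union>K = K"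
proof -
  interpret normal N G
    by (rule N)
  have eq: "N #> g = R" if R: "R \<in> K" "g \<in> R" for R g
  proof -
    obtain h where h: "h \<in> carrier G" "R = N #> h"
      using R K by (auto simp: carrier_FactGroup)
    show ?thesis
      using repr_independence[OF R(2)[unfolded h(2)] h(1) is_subgroup] h(2) by simp
  qed
  have ne: "\<exists>g. g \<in> R" if R: "R \<in> K" for R
  proof -
    obtain h where h: "h \<in> carrier G" "R = N #> h"
      using R K by (auto simp: carrier_FactGroup)
    show ?thesis
      using rcos_self[OF h(1) is_subgroup] h(2) by blast
  qed
  show ?thesis
  proof
    show "(\<lambda>g. N #> g) ` \<Union>K \<subseteq> K"
      using eq by auto
    show "K \<subseteq> (\<lambda>g. N #> g) ` \<Union>K"
    proof
      fix R assume R: "R \<in> K"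
      then obtain g where "g \<in> R"
        using ne by blast
      then show "R \<in> (\<lambda>g. N #> g) ` \<Union>K"
        using eq[OF R, of g, symmetric] R by blast
    qed
  qed
qed

lemma mem_Union_FactGroup:
  fixes G (structure)
  assumes N: "N \<lhd> G" and K: "K \<subseteq> carrier (G Mod N)" and g: "g \<in> carrier G"
  shows "g \<in> \<Union>K \<longleftrightarrow> N #>\<^bsub>G\<^esub> g \<in> K"
proof -
  interpret normal N G
    by (rule N)
  show ?thesis
  proof
    show "g \<in> \<Union>K \<Longrightarrow> N #> g \<in> K"
      using FactGroup_image_Union[OF N K] by (metis imageI)
    show "N #> g \<in> K \<Longrightarrow> g \<in> \<Union>K"
      by (rule UnionI[OF _ rcos_self[OF g is_subgroup]])
  qed
qed

lemma Union_FactGroup_subset: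
  fixes G (structure)
  assumes N: "N \<lhd> G" and K: "K \<subseteq> carrier (G Mod N)"
  shows "\<Union>K \<subseteq> carrier G"
proof -
  interpret normal N G
    by (rule N)
  show ?thesis
    using K rcosets_part_G[OF is_subgroup] by (auto simp: FactGroup_def)
qed

lemma subgroup_Union_FactGroup:
  fixes G (structure)
  assumes N: "N \<lhd> G" and K: "subgroup K (G Mod N)"
  shows "subgroup (\<Union>K) G"
proof -
  interpret normal N G
    by (rule N)
  interpret Q: group "G Mod N"
    by (rule factorgroup_is_group)
  note K' = subgroup.subset[OF K]
  note mem = mem_Union_FactGroup[OF N K']
  have hom: "group_hom G (G Mod N) (\<lambda>g. N #> g)"
    by unfold_locales (rule r_coset_hom_Mod)
  note sub = Union_FactGroup_subset[OF N K']
  show ?thesis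
  proof (rule subgroupI)
    show "\<Union>K \<noteq> {}"
      using mem[OF one_closed] subgroup.one_closed[OF K] subset by auto
  next
    fix g assume g: "g \<in> \<Union>K"
    then have "g \<in> carrier G" "N #> g \<in> K"
      using sub mem by auto
    then show "inv g \<in> \<Union>K"
      using mem[of "inv g"] subgroup.m_inv_closed[OF K] group_hom.hom_inv[OF hom] by simp
  next
    fix g h assume "g \<in> \<Union>K" "h \<in> \<Union>K"
    then have "g \<in> carrier G" "N #> g \<in> K" "h \<in> carrier G" "N #> h \<in> K"
      using sub mem by auto
    then show "g \<otimes> h \<in> \<Union>K"
      using mem[of "g \<otimes> h"] subgroup.m_closed[OF K] group_hom.hom_mult[OF hom] by simp
  qed (rule sub)
qed

lemma subgroup_image_FactGroup:
  fixes G (structure)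
  assumes N: "N \<lhd> G" and K: "subgroup K G"
  shows "subgroup ((\<lambda>g. N #>\<^bsub>G\<^esub> g) ` K) (G Mod N)"
proof -
  interpret normal N G
    by (rule N)
  interpret Q: group "G Mod N"
    by (rule factorgroup_is_group)
  have "group_hom G (G Mod N) (\<lambda>g. N #> g)"
    by unfold_locales (rule r_coset_hom_Mod)
  then show ?thesis
    using K group_hom.subgroup_img_is_subgroup by blast
qed

text \<open>The inflation is transitive, and the stabilizer of its base point is the preimage of
  \<open>Q\<close>; the orbit-stabilizer theorem applies once this preimage is seen to be
  \<open>H\<close>.\<close>

lemma inflate_coset_gset_iso:
  fixes G (structure)
  assumes N: "N \<lhd> G" and fin: "finite (carrier G)" and H: "subgroup H G" and NH: "N \<subseteq> H"
  defines "Q \<equiv> (\<lambda>g. N #>\<^bsub>G\<^esub> g) ` H"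
  shows "gset_iso G (inflate G N (coset_gset (G Mod N) Q)) (coset_gset G H)"
proof -
  interpret normal N G
    by (rule N)
  interpret Q: group "G Mod N"
    by (rule factorgroup_is_group)
  have finQ: "finite (carrier (G Mod N))"
    using fin by (simp add: carrier_FactGroup)
  have Q: "subgroup Q (G Mod N)"
    unfolding Q_def by (rule subgroup_image_FactGroup[OF N H])
  let ?Y = "coset_gset (G Mod N) Q"
  let ?X = "inflate G N ?Y"
  have "stabilizer G (snd ?X) Q = {g \<in> carrier G. N #> g \<in> Q}"
    by (simp add: stabilizer_inflate Q.stabilizer_coset_gset_base[OF Q])
  also have "\<dots> = H"
  proof
    show "H \<subseteq> {g \<in> carrier G. N #> g \<in> Q}"
      using subgroup.subset[OF H] by (auto simp: Q_def)
    \<comment> \<open>Here \<open>N \<subseteq> H\<close> enters: an element of the coset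
      \<open>N h\<close> with \<open>h\<close> in \<open>H\<close> is a product of two elements of
      \<open>H\<close>.\<close>
    show "{g \<in> carrier G. N #> g \<in> Q} \<subseteq> H"
    proof clarify
      fix g assume g: "g \<in> carrier G" "N #> g \<in> Q"
      then obtain h where h: "h \<in> H" "N #> g = N #> h"
        by (auto simp: Q_def)
      then have "g \<in> N #> h"
        using rcos_self[OF g(1) is_subgroup] by simp
      then obtain n where "n \<in> N" "g = n \<otimes> h"
        by (auto simp: r_coset_def)
      then show "g \<in> H"
        using h NH subgroup.m_closed[OF H] by blast
    qed
  qed
  finally have st: "stabilizer G (snd ?X) Q = H" .
  have "fst ?X \<subseteq> orbit G (snd ?X) Q"
    using Q.coset_gset_transitive[OF Q] by (auto simp: inflate_def orbit_def carrier_FactGroup)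
  moreover have "Q \<in> fst ?X"
    using Q.coset_gset_base(1)[OF Q] by (simp add: inflate_def)
  ultimately show ?thesis
    using coset_gset_iso[OF fin finite_gset_inflate[OF N Q.finite_gset_coset[OF finQ Q]]] st
    by metis
qed

text \<open>This is the value of taking fixed points at \<open>[G/H]\<close>, read off from marks at
  preimages. If \<open>N \<subseteq> H\<close>, then \<open>G/H\<close> is an inflation, and
  inflated marks see only the image of a subgroup.\<close>

lemma mark_coset_gset_FactGroup:
  fixes G (structure)
  assumes N: "N \<lhd> G" and fin: "finite (carrier G)" and H: "subgroup H G"
    and K: "subgroup K (G Mod N)"
  shows "mark (coset_gset G H) (\<Union>K) =
    (if N \<subseteq> H then mark (coset_gset (G Mod N) ((\<lambda>g. N #>\<^bsub>G\<^esub> g) ` H)) K else 0)"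
proof (cases "N \<subseteq> H")
  case True
  interpret normal N G
    by (rule N)
  interpret Q: group "G Mod N"
    by (rule factorgroup_is_group)
  have finQ: "finite (carrier (G Mod N))"
    using fin by (simp add: carrier_FactGroup)
  note sub = Union_FactGroup_subset[OF N subgroup.subset[OF K]]
  have "mark (coset_gset G H) (\<Union>K) =
      mark (inflate G N (coset_gset (G Mod N) ((\<lambda>g. N #> g) ` H))) (\<Union>K)"
    using mark_gset_iso[OF _ inflate_coset_gset_iso[OF N fin H True] sub]
      finite_gset_inflate[OF N Q.finite_gset_coset[OF finQ subgroup_image_FactGroup[OF N H]]]
    by simp
  then show ?thesis
    using True by (simp add: mark_inflate FactGroup_image_Union[OF N subgroup.subset[OF K]])
next
  case False
  interpret normal N G
    by (rule N)
  note sub = Union_FactGroup_subset[OF N subgroup.subset[OF K]]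
  have NK: "N \<subseteq> \<Union>K"
    using subgroup.one_closed[OF K] by auto
  have "\<not> \<Union>K \<subseteq> L" if L: "L \<in> conj_class G H" for L
  proof
    assume "\<Union>K \<subseteq> L"
    then have NL: "N \<subseteq> L"
      using NK by blast
    obtain a where a: "a \<in> carrier G" "L = a <# H #> inv a"
      using L by (auto simp: conj_class_def)
    \<comment> \<open>By normality a conjugate of \<open>H\<close> contains \<open>N\<close> only if
      \<open>H\<close> does: \<open>a n a^-1\<close> lies in \<open>N\<close>, hence in
      \<open>L\<close>, and conjugating back puts \<open>n\<close> in \<open>H\<close>.\<close>
    have "n \<in> H" if n: "n \<in> N" for n
    proof -
      have n': "a \<otimes> n \<otimes> inv a \<in> carrier G" "a \<otimes> n \<otimes> inv a \<in> L"
        using inv_op_closed2[OF a(1) n] NL subset by auto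
      then have "inv a \<otimes> (a \<otimes> n \<otimes> inv a \<otimes> a) \<in> H"
        using mem_conj_iff[OF subgroup.subset[OF H] a(1) n'(1)] a(2) by simp
      moreover have "inv a \<otimes> (a \<otimes> n \<otimes> inv a \<otimes> a) = n"
        using a(1) n subset by (simp add: m_assoc subset_iff) (simp add: m_assoc[symmetric] subset_iff)
      ultimately show ?thesis
        by simp
    qed
    then show False
      using False by blast
  qed
  then have "mark (coset_gset G H) (\<Union>K) = 0"
    using mark_coset_gset_pos_iff[OF fin H sub] by blast
  then show ?thesis
    using False by simp
qed

text \<open>Cores are intersections of stabilizers, and stabilizers of an inflation are preimages.
  So the core of \<open>H\<close> is the preimage of the core of \<open>H/N\<close>, and the
  subgroup with preimage \<open>N\<close> is the trivial one, whose single element is the coset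
  \<open>N\<close>.\<close>

lemma normal_core_FactGroup:
  fixes G (structure)
  assumes N: "N \<lhd> G" and fin: "finite (carrier G)" and H: "subgroup H G" and NH: "N \<subseteq> H"
  shows "normal_core (G Mod N) ((\<lambda>g. N #>\<^bsub>G\<^esub> g) ` H) = {\<one>\<^bsub>G Mod N\<^esub>} \<longleftrightarrow> normal_core G H = N"
proof -
  interpret normal N G
    by (rule N)
  interpret Q: group "G Mod N"
    by (rule factorgroup_is_group)
  have finQ: "finite (carrier (G Mod N))"
    using fin by (simp add: carrier_FactGroup)
  define Q where "Q = (\<lambda>g. N #> g) ` H"
  have Q: "subgroup Q (G Mod N)"
    unfolding Q_def by (rule subgroup_image_FactGroup[OF N H])
  let ?Y = "coset_gset (G Mod N) Q"
  have fY: "finite_gset G (inflate G N ?Y)"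
    by (rule finite_gset_inflate[OF N Q.finite_gset_coset[OF finQ Q]])
  have "conj_class G H = stabilizer G (snd (inflate G N ?Y)) ` fst ?Y"
    using stabilizers_gset_iso[OF fY inflate_coset_gset_iso[OF N fin H NH, folded Q_def]]
      conj_class_eq_stabilizers[OF fin H] by (simp add: inflate_def)
  moreover have "conj_class (G Mod N) Q = stabilizer (G Mod N) (snd ?Y) ` fst ?Y"
    by (rule Q.conj_class_eq_stabilizers[OF finQ Q])
  \<comment> \<open>The intersection has to run over a nonempty family: only then does it stay
    inside \<open>carrier G\<close> like the preimages it is formed from.\<close>
  moreover have ne: "fst ?Y \<noteq> {}"
    using Q.coset_gset_base(1)[OF Q] by blast
  ultimately have core: "normal_core G H = {g \<in> carrier G. N #> g \<in> normal_core (G Mod N) Q}"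
    unfolding normal_core_eq_Inter stabilizer_inflate by auto
  have cQ: "normal_core (G Mod N) Q \<subseteq> carrier (G Mod N)"
    using Inter_lower[OF Q.conj_class_self[OF Q]] subgroup.subset[OF Q]
    unfolding normal_core_eq_Inter by (rule subset_trans)
  have "normal_core G H = \<Union>(normal_core (G Mod N) Q)"
  proof (rule Set.set_eqI)
    fix g
    show "g \<in> normal_core G H \<longleftrightarrow> g \<in> \<Union>(normal_core (G Mod N) Q)"
    proof (cases "g \<in> carrier G")
      case True
      then show ?thesis
        using mem_Union_FactGroup[OF N cQ True] by (simp add: core)
    next
      case False
      then show ?thesis
        using subsetD[OF Union_FactGroup_subset[OF N cQ], of g] by (auto simp: core)
    qed
  qed
  moreover have "normal_core (G Mod N) Q = {N}" if "\<Union>(normal_core (G Mod N) Q) = N"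
  proof -
    have "normal_core (G Mod N) Q = (\<lambda>g. N #> g) ` N"
      using FactGroup_image_Union[OF N cQ] that by simp
    also have "\<dots> = (\<lambda>g. N) ` N"
      using coset_join2[OF _ is_subgroup] subset by (intro image_cong) auto
    also have "\<dots> = {N}"
      using subgroup.one_closed[OF is_subgroup] by (rule image_constant)
    finally show ?thesis .
  qed
  ultimately show ?thesis
    unfolding Q_def[symmetric] one_FactGroup by (metis ccpo_Sup_singleton)
qed

section \<open>The fixed points of \<open>N\<close> as a set acted on by \<open>G/N\<close>\<close>

text \<open>A coset acts through an arbitrary element of it; \<open>fixed_gset_act\<close> shows the
  choice to be immaterial on points fixed by \<open>N\<close>.\<close>

definition fixed_gset :: "('a, 'm) monoid_scheme \<Rightarrow> 'a set \<Rightarrow> ('a, 'e) gset \<Rightarrow> ('a set, 'e) gset"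
  where "fixed_gset G N X =
    (let F = {x \<in> fst X. \<forall>n\<in>N. snd X n x = x} in (F, \<lambda>K. \<lambda>x\<in>F. snd X (SOME g. g \<in> K) x))"

text \<open>By normality the coset \<open>N h\<close> is also \<open>h N\<close>, so each of its
  elements acts first by some \<open>n\<close> in \<open>N\<close>, which fixes \<open>x\<close>,
  and then by \<open>h\<close>.\<close>

lemma fixed_gset_act:
  fixes G (structure)
  assumes N: "N \<lhd> G" and X: "finite_gset G X" and x: "x \<in> fst (fixed_gset G N X)"
    and K: "K \<in> carrier (G Mod N)" and g: "g \<in> K"
  shows "snd (fixed_gset G N X) K x = snd X g x"
proof -
  interpret normal N G
    by (rule N)
  have x': "x \<in> fst X" "\<And>n. n \<in> N \<Longrightarrow> snd X n x = x"
    using x by (auto simp: fixed_gset_def Let_def)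
  obtain h where h: "h \<in> carrier G" "K = N #> h"
    using K by (auto simp: carrier_FactGroup)
  have eq: "snd X k x = snd X h x" if k: "k \<in> K" for k
  proof -
    obtain n where n: "n \<in> N" "k = h \<otimes> n"
      using k coset_eq[rule_format, OF h(1)] unfolding h(2) by (auto simp: l_coset_def)
    then show ?thesis
      using finite_gset_mult[OF X h(1) _ x'(1), of n] x'(2)[OF n(1)] subset by auto
  qed
  have "snd X (SOME k. k \<in> K) x = snd X g x"
    using eq[OF g] eq[OF someI[of "\<lambda>k. k \<in> K", OF g]] by simp
  then show ?thesis
    using x by (simp add: fixed_gset_def Let_def)
qed

text \<open>Normality again: \<open>n g = g (g^-1 n g)\<close>, and the bracket lies in
  \<open>N\<close> and fixes \<open>x\<close>.\<close>

lemma fixed_gset_closed: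
  fixes G (structure)
  assumes N: "N \<lhd> G" and X: "finite_gset G X" and x: "x \<in> fst (fixed_gset G N X)"
    and g: "g \<in> carrier G"
  shows "snd X g x \<in> fst (fixed_gset G N X)"
proof -
  interpret normal N G
    by (rule N)
  have x': "x \<in> fst X" "\<And>n. n \<in> N \<Longrightarrow> snd X n x = x"
    using x by (auto simp: fixed_gset_def Let_def)
  have "snd X n (snd X g x) = snd X g x" if n: "n \<in> N" for n
  proof -
    have nG: "n \<in> carrier G"
      using n subset by blast
    have m: "inv g \<otimes> n \<otimes> g \<in> N"
      using inv_op_closed1[OF g n] .
    have "n \<otimes> g = g \<otimes> (inv g \<otimes> n \<otimes> g)"
      using g nG by (simp add: m_assoc[symmetric])
    then have "snd X (n \<otimes> g) x = snd X g (snd X (inv g \<otimes> n \<otimes> g) x)"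
      using finite_gset_mult[OF X g _ x'(1), of "inv g \<otimes> n \<otimes> g"] m subset by auto
    then show ?thesis
      using finite_gset_mult[OF X nG g x'(1)] x'(2)[OF m] by simp
  qed
  then show ?thesis
    using finite_gset_closed[OF X g x'(1)] by (simp add: fixed_gset_def Let_def)
qed

lemma finite_gset_fixed:
  fixes G (structure)
  assumes N: "N \<lhd> G" and X: "finite_gset G X"
  shows "finite_gset (G Mod N) (fixed_gset G N X)"
proof -
  interpret normal N G
    by (rule N)
  interpret Q: group "G Mod N"
    by (rule factorgroup_is_group)
  have rep: "\<exists>g\<in>carrier G. g \<in> K \<and> K = N #> g" if K: "K \<in> carrier (G Mod N)" for K
  proof -
    obtain h where h: "h \<in> carrier G" "K = N #> h"
      using K by (auto simp: carrier_FactGroup)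
    show ?thesis
      using rcos_self[OF h(1) is_subgroup] h by blast
  qed
  note act = fixed_gset_act[OF N X] and cl = fixed_gset_closed[OF N X]
  show ?thesis
  proof (rule Q.finite_gsetI)
    show "finite (fst (fixed_gset G N X))"
      using finite_gset_finite[OF X] by (simp add: fixed_gset_def Let_def)
    show "snd (fixed_gset G N X) K \<in> extensional (fst (fixed_gset G N X))" for K
      by (simp add: fixed_gset_def Let_def)
  next
    fix K x assume K: "K \<in> carrier (G Mod N)" and x: "x \<in> fst (fixed_gset G N X)"
    obtain g where g: "g \<in> carrier G" "g \<in> K"
      using rep[OF K] by blast
    then show "snd (fixed_gset G N X) K x \<in> fst (fixed_gset G N X)"
      using act[OF x K g(2)] cl[OF x g(1)] by simp
  next
    fix x assume x: "x \<in> fst (fixed_gset G N X)"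
    then have "x \<in> fst X"
      by (simp add: fixed_gset_def Let_def)
    then show "snd (fixed_gset G N X) \<one>\<^bsub>G Mod N\<^esub> x = x"
      using act[OF x Q.one_closed, of \<one>] finite_gset_one[OF X] by simp
  next
    fix K L x assume K: "K \<in> carrier (G Mod N)" and L: "L \<in> carrier (G Mod N)"
      and x: "x \<in> fst (fixed_gset G N X)"
    obtain g where g: "g \<in> carrier G" "g \<in> K" "K = N #> g"
      using rep[OF K] by blast
    obtain h where h: "h \<in> carrier G" "h \<in> L" "L = N #> h"
      using rep[OF L] by blast
    have "g \<otimes> h \<in> K \<otimes>\<^bsub>G Mod N\<^esub> L"
      using g(2) h(2) by (auto simp: set_mult_def)
    then have "snd (fixed_gset G N X) (K \<otimes>\<^bsub>G Mod N\<^esub> L) x = snd X (g \<otimes> h) x"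
      using act[OF x Q.m_closed[OF K L]] by blast
    also have "\<dots> = snd X g (snd X h x)"
      using finite_gset_mult[OF X g(1) h(1)] x by (simp add: fixed_gset_def Let_def)
    finally show "snd (fixed_gset G N X) (K \<otimes>\<^bsub>G Mod N\<^esub> L) x =
        snd (fixed_gset G N X) K (snd (fixed_gset G N X) L x)"
      using act[OF x L h(2)] act[OF cl[OF x h(1)] K g(2)] by simp
  qed
qed

text \<open>The identity of \<open>G Mod N\<close> is \<open>N\<close>, so \<open>\<Union>K\<close>
  contains \<open>N\<close> and every point fixed by \<open>\<Union>K\<close> already belongs to the
  carrier of \<open>fixed_gset\<close>.\<close>

lemma mark_fixed_gset:
  fixes G (structure)
  assumes N: "N \<lhd> G" and X: "finite_gset G X" and K: "subgroup K (G Mod N)"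
  shows "mark (fixed_gset G N X) K = mark X (\<Union>K)"
proof -
  interpret normal N G
    by (rule N)
  have NK: "N \<subseteq> \<Union>K"
    using subgroup.one_closed[OF K] by auto
  have act: "snd (fixed_gset G N X) R x = snd X g x"
    if "R \<in> K" "g \<in> R" "x \<in> fst (fixed_gset G N X)" for R g x
    using fixed_gset_act[OF N X that(3) _ that(2)] that(1) subgroup.subset[OF K] by blast
  have ne: "\<exists>g. g \<in> R" if R: "R \<in> K" for R
  proof -
    obtain h where h: "h \<in> carrier G" "R = N #> h"
      using R subgroup.subset[OF K] by (auto simp: carrier_FactGroup)
    show ?thesis
      using rcos_self[OF h(1) is_subgroup] h(2) by blast
  qed
  have "(x \<in> fst (fixed_gset G N X) \<and> (\<forall>R\<in>K. snd (fixed_gset G N X) R x = x)) \<longleftrightarrow>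
      (x \<in> fst X \<and> (\<forall>g\<in>\<Union>K. snd X g x = x))" for x
  proof (cases "x \<in> fst (fixed_gset G N X)")
    case True
    moreover from True have "x \<in> fst X"
      by (simp add: fixed_gset_def Let_def)
    ultimately show ?thesis
      using act ne by (metis UnionE UnionI)
  next
    case False
    then show ?thesis
      using NK by (auto simp: fixed_gset_def Let_def)
  qed
  then show ?thesis
    by (simp add: mark_def)
qed

section \<open>The Burnside ring in terms of marks\<close>

text \<open>Transport of structure along a numbering of the points. It brings sums, products and
  coset spaces, whose points have other types, back to the representatives that
  \<open>vclass\<close> admits.\<close>

lemma ex_nat_gset_iso:
  assumes X: "finite_gset G X"
  obtains A :: "('a, nat) gset" where "finite_gset G A" "gset_iso G X A"
proof -
  interpret group G
    using finite_gset_group[OF X] .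
  obtain h where h: "bij_betw h (fst X) {0..<card (fst X)}"
    using ex_bij_betw_finite_nat[OF finite_gset_finite[OF X]] by blast
  let ?n = "{0..<card (fst X)}"
  define k where "k = inv_into (fst X) h"
  have k: "k i \<in> fst X" "h (k i) = i" if "i \<in> ?n" for i
    using bij_betw_apply[OF bij_betw_inv_into[OF h] that] bij_betw_inv_into_right[OF h that]
    by (simp_all add: k_def)
  have hX: "h x \<in> ?n" "k (h x) = x" if "x \<in> fst X" for x
    using bij_betw_apply[OF h that] bij_betw_inv_into_left[OF h that] by (simp_all add: k_def)
  define A :: "('a, nat) gset" where "A = (?n, \<lambda>g. \<lambda>i\<in>?n. h (snd X g (k i)))"
  have act: "snd A g i = h (snd X g (k i))" if "i \<in> ?n" for g i
    using that by (simp add: A_def)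
  have fst_A: "fst A = ?n"
    by (simp add: A_def)
  have closed: "h (snd X g (k i)) \<in> ?n" if "g \<in> carrier G" "i \<in> ?n" for g i
    using hX(1)[OF finite_gset_closed[OF X that(1) k(1)[OF that(2)]]] .
  have "finite_gset G A"
  proof (rule finite_gsetI)
    show "snd A g \<in> extensional (fst A)" for g
      by (simp add: A_def)
    show "snd A g i \<in> fst A" if "g \<in> carrier G" "i \<in> fst A" for g i
      using closed act that unfolding fst_A by simp
    show "snd A \<one>\<^bsub>G\<^esub> i = i" if "i \<in> fst A" for i
      using that k[of i] finite_gset_one[OF X] act[of i] unfolding fst_A by simp
    show "snd A (g \<otimes>\<^bsub>G\<^esub> h) i = snd A g (snd A h i)"
      if gh: "g \<in> carrier G" "h \<in> carrier G" and i: "i \<in> fst A" for g h i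
    proof -
      have i': "i \<in> ?n"
        using i by (simp add: fst_A)
      show ?thesis
        unfolding act[OF i'] act[OF closed[OF gh(2) i']]
          finite_gset_mult[OF X gh k(1)[OF i']] hX(2)[OF finite_gset_closed[OF X gh(2) k(1)[OF i']]] ..
    qed
  qed (simp add: fst_A)
  moreover have "gset_iso G X A"
    unfolding gset_iso_def fst_A using h act hX by (intro exI[of _ h]) simp
  ultimately show thesis
    by (rule that)
qed

definition diff_mark :: "('a, 'e) gset \<Rightarrow> ('a, 'f) gset \<Rightarrow> 'a set \<Rightarrow> int"
  where "diff_mark X Y K = int (mark X K) - int (mark Y K)"

text \<open>A ring element is the set of all pairs representing it. An arbitrary one is evaluated,
  and by \<open>virtual_mark_vclass\<close> all of them agree at subgroups.\<close>

definition virtual_mark :: "(('a, nat) gset \<times> ('a, nat) gset) set \<Rightarrow> 'a set \<Rightarrow> int"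
  where "virtual_mark x K = (case SOME p. p \<in> x of (A, B) \<Rightarrow> diff_mark A B K)"

locale finite_group = group +
  assumes finite_carrier: "finite (carrier G)"
begin

section \<open>Equality and ring operations in terms of marks\<close>

text \<open>Marks are additive, so the auxiliary \<open>Z\<close> cancels. Conversely Burnside's
  theorem produces the isomorphism, with \<open>Z\<close> empty.\<close>

lemma vdiff_eq_iff:
  assumes X: "finite_gset G X" and Y: "finite_gset G Y"
    and X': "finite_gset G X'" and Y': "finite_gset G Y'"
  shows "vdiff_eq G X Y X' Y' \<longleftrightarrow> (\<forall>K. subgroup K G \<longrightarrow> diff_mark X Y K = diff_mark X' Y' K)"
proof
  assume "vdiff_eq G X Y X' Y'"
  then obtain Z :: "('a, nat) gset" where Z: "finite_gset G Z"
    and iso: "gset_iso G (gset_sum (gset_sum X Y') Z) (gset_sum (gset_sum X' Y) Z)"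
    by (auto simp: vdiff_eq_def)
  show "\<forall>K. subgroup K G \<longrightarrow> diff_mark X Y K = diff_mark X' Y' K"
  proof (intro allI impI)
    fix K assume K: "subgroup K G"
    have "mark (gset_sum (gset_sum X Y') Z) K = mark (gset_sum (gset_sum X' Y) Z) K"
      by (rule mark_gset_iso[OF finite_gset_sum[OF finite_gset_sum[OF X Y'] Z] iso subgroup.subset[OF K]])
    then show "diff_mark X Y K = diff_mark X' Y' K"
      by (simp add: mark_gset_sum finite_gset_finite[OF X] finite_gset_finite[OF Y]
          finite_gset_finite[OF X'] finite_gset_finite[OF Y'] finite_gset_finite[OF Z]
          finite_gset_finite[OF finite_gset_sum[OF X Y']]
          finite_gset_finite[OF finite_gset_sum[OF X' Y]] diff_mark_def)
  qed
next
  assume eq: "\<forall>K. subgroup K G \<longrightarrow> diff_mark X Y K = diff_mark X' Y' K"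
  let ?Z = "trivial_gset ({} :: nat set)"
  have Z: "finite_gset G ?Z"
    by (rule finite_gset_trivial) simp
  have "gset_iso G (gset_sum (gset_sum X Y') ?Z) (gset_sum (gset_sum X' Y) ?Z)"
  proof (rule gset_iso_if_marks_eq[OF finite_gset_sum[OF finite_gset_sum[OF X Y'] Z]
        finite_gset_sum[OF finite_gset_sum[OF X' Y] Z] finite_carrier])
    fix K assume "subgroup K G"
    then have "diff_mark X Y K = diff_mark X' Y' K"
      using eq by blast
    then show "mark (gset_sum (gset_sum X Y') ?Z) K = mark (gset_sum (gset_sum X' Y) ?Z) K"
      by (simp add: mark_gset_sum finite_gset_finite[OF X] finite_gset_finite[OF Y]
          finite_gset_finite[OF X'] finite_gset_finite[OF Y'] finite_gset_finite[OF Z]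
          finite_gset_finite[OF finite_gset_sum[OF X Y']]
          finite_gset_finite[OF finite_gset_sum[OF X' Y]] diff_mark_def)
  qed
  then show "vdiff_eq G X Y X' Y'"
    unfolding vdiff_eq_def using Z by blast
qed

lemma mem_vclass_iff:
  assumes "finite_gset G X" "finite_gset G Y"
  shows "(A, B) \<in> vclass G X Y \<longleftrightarrow> finite_gset G A \<and> finite_gset G B \<and>
    (\<forall>K. subgroup K G \<longrightarrow> diff_mark A B K = diff_mark X Y K)"
  using vdiff_eq_iff[OF _ _ assms, of A B] by (auto simp: vclass_def)

lemma vclass_eqI:
  assumes "finite_gset G X" "finite_gset G Y" "finite_gset G X'" "finite_gset G Y'"
    and "\<And>K. subgroup K G \<Longrightarrow> diff_mark X Y K = diff_mark X' Y' K"
  shows "vclass G X Y = vclass G X' Y'"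
  using mem_vclass_iff[OF assms(1,2)] mem_vclass_iff[OF assms(3,4)] assms(5) by auto

text \<open>Besides supplying representatives on natural numbers, this shows that classes are
  nonempty, on which \<open>virtual_mark\<close> and the unions in the ring operations rely.\<close>

lemma vclass_nat_rep:
  assumes X: "finite_gset G X" and Y: "finite_gset G Y"
  obtains A B where "finite_gset G A" "finite_gset G B" "(A, B) \<in> vclass G X Y"
    "vclass G A B = vclass G X Y"
proof -
  obtain A :: "('a, nat) gset" where A: "finite_gset G A" "gset_iso G X A"
    using ex_nat_gset_iso[OF X] .
  obtain B :: "('a, nat) gset" where B: "finite_gset G B" "gset_iso G Y B"
    using ex_nat_gset_iso[OF Y] .
  have eq: "diff_mark A B K = diff_mark X Y K" if "subgroup K G" for K
    using mark_gset_iso[OF X A(2)] mark_gset_iso[OF Y B(2)] subgroup.subset[OF that]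
    by (simp add: diff_mark_def)
  show thesis
    by (rule that[OF A(1) B(1)]) (use A(1) B(1) X Y eq in \<open>auto simp: mem_vclass_iff intro: vclass_eqI\<close>)
qed

lemma vclass_in_carrier:
  assumes "finite_gset G X" "finite_gset G Y"
  shows "vclass G X Y \<in> carrier (burnside_ring G)"
proof -
  obtain A B :: "('a, nat) gset" where "finite_gset G A" "finite_gset G B"
    and eq: "vclass G A B = vclass G X Y"
    using vclass_nat_rep[OF assms] .
  then show ?thesis
    unfolding burnside_ring_def partial_object.simps eq[symmetric] by blast
qed

lemma burnside_ring_carrierE:
  assumes "x \<in> carrier (burnside_ring G)"
  obtains A B :: "('a, nat) gset" where "finite_gset G A" "finite_gset G B" "x = vclass G A B"
  using assms by (auto simp: burnside_ring_def)

lemma virtual_mark_vclass: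
  assumes X: "finite_gset G X" and Y: "finite_gset G Y" and K: "subgroup K G"
  shows "virtual_mark (vclass G X Y) K = diff_mark X Y K"
proof -
  obtain A B where "(A, B) \<in> vclass G X Y"
    using vclass_nat_rep[OF X Y] .
  then have "(SOME p. p \<in> vclass G X Y) \<in> vclass G X Y"
    by (rule someI[of "\<lambda>p. p \<in> vclass G X Y"])
  then show ?thesis
    using mem_vclass_iff[OF X Y] K by (auto simp: virtual_mark_def split: prod.split)
qed

text \<open>Injectivity of the embedding by marks; the ring identities below are reduced to integer
  arithmetic through it.\<close>

lemma burnside_ring_eqI:
  assumes x: "x \<in> carrier (burnside_ring G)" and y: "y \<in> carrier (burnside_ring G)"
    and eq: "\<And>K. subgroup K G \<Longrightarrow> virtual_mark x K = virtual_mark y K"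
  shows "x = y"
proof -
  obtain A B :: "('a, nat) gset" where AB: "finite_gset G A" "finite_gset G B" "x = vclass G A B"
    using burnside_ring_carrierE[OF x] .
  obtain C D :: "('a, nat) gset" where CD: "finite_gset G C" "finite_gset G D" "y = vclass G C D"
    using burnside_ring_carrierE[OF y] .
  show ?thesis
    unfolding AB(3) CD(3)
    by (rule vclass_eqI[OF AB(1,2) CD(1,2)])
      (use eq in \<open>simp add: virtual_mark_vclass[OF AB(1,2)] virtual_mark_vclass[OF CD(1,2)] AB(3) CD(3)\<close>)
qed

text \<open>Collapses the unions in the definitions of \<open>add\<close> and \<open>mult\<close>: a
  union of equal sets over a nonempty index set is that set.\<close>

lemma UN_vclass:
  assumes X: "finite_gset G X" and Y: "finite_gset G Y" and X': "finite_gset G X'" and Y': "finite_gset G Y'"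
    and const: "\<And>A B C D. (A, B) \<in> vclass G X Y \<Longrightarrow> (C, D) \<in> vclass G X' Y' \<Longrightarrow> F A B C D = S"
  shows "(\<Union>(A, B)\<in>vclass G X Y. \<Union>(C, D)\<in>vclass G X' Y'. F A B C D) = S"
proof -
  obtain A B where AB: "(A, B) \<in> vclass G X Y"
    using vclass_nat_rep[OF X Y] .
  obtain C D where CD: "(C, D) \<in> vclass G X' Y'"
    using vclass_nat_rep[OF X' Y'] .
  show ?thesis
  proof (rule SUP_eq_const)
    fix p assume p: "p \<in> vclass G X Y"
    have "(\<Union>(C, D)\<in>vclass G X' Y'. F (fst p) (snd p) C D) = S"
      by (rule SUP_eq_const) (use CD const[of "fst p" "snd p"] p in auto)
    then show "(case p of (A, B) \<Rightarrow> \<Union>(C, D)\<in>vclass G X' Y'. F A B C D) = S"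
      by (simp add: case_prod_beta)
  qed (use AB in blast)
qed

lemma burnside_add_vclass:
  assumes A: "finite_gset G A" "finite_gset G B" and C: "finite_gset G C" "finite_gset G D"
  shows "vclass G A B \<oplus>\<^bsub>burnside_ring G\<^esub> vclass G C D = vclass G (gset_sum A C) (gset_sum B D)"
  unfolding burnside_ring_def ring_record_simps
proof (rule UN_vclass[OF A C])
  fix A' B' C' D'
  assume "(A', B') \<in> vclass G A B" "(C', D') \<in> vclass G C D"
  then have A': "finite_gset G A'" "finite_gset G B'" and C': "finite_gset G C'" "finite_gset G D'"
    and eq: "\<And>K. subgroup K G \<Longrightarrow> diff_mark A' B' K = diff_mark A B K"
      "\<And>K. subgroup K G \<Longrightarrow> diff_mark C' D' K = diff_mark C D K"
    using mem_vclass_iff[OF A] mem_vclass_iff[OF C] by auto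
  show "vclass G (gset_sum A' C') (gset_sum B' D') = vclass G (gset_sum A C) (gset_sum B D)"
  proof (rule vclass_eqI)
    fix K assume "subgroup K G"
    from eq[OF this]
    show "diff_mark (gset_sum A' C') (gset_sum B' D') K = diff_mark (gset_sum A C) (gset_sum B D) K"
      by (simp add: diff_mark_def mark_gset_sum finite_gset_finite[OF A(1)] finite_gset_finite[OF A(2)]
          finite_gset_finite[OF C(1)] finite_gset_finite[OF C(2)] finite_gset_finite[OF A'(1)]
          finite_gset_finite[OF A'(2)] finite_gset_finite[OF C'(1)] finite_gset_finite[OF C'(2)])
  qed (intro finite_gset_sum A C A' C')+
qed

lemma diff_mark_mult:
  assumes A: "finite_gset G A" "finite_gset G B" and C: "finite_gset G C" "finite_gset G D"
  shows "diff_mark (gset_sum (gset_prod A C) (gset_prod B D)) (gset_sum (gset_prod A D) (gset_prod B C)) K =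
    diff_mark A B K * diff_mark C D K"
  by (simp add: diff_mark_def mark_gset_sum mark_gset_prod algebra_simps
      finite_gset_finite[OF finite_gset_prod[OF A(1) C(1)]] finite_gset_finite[OF finite_gset_prod[OF A(1) C(2)]]
      finite_gset_finite[OF finite_gset_prod[OF A(2) C(1)]] finite_gset_finite[OF finite_gset_prod[OF A(2) C(2)]])

lemma burnside_mult_vclass:
  assumes A: "finite_gset G A" "finite_gset G B" and C: "finite_gset G C" "finite_gset G D"
  shows "vclass G A B \<otimes>\<^bsub>burnside_ring G\<^esub> vclass G C D =
    vclass G (gset_sum (gset_prod A C) (gset_prod B D)) (gset_sum (gset_prod A D) (gset_prod B C))"
  unfolding burnside_ring_def monoid.simps ring_record_simps
proof (rule UN_vclass[OF A C])
  fix A' B' C' D'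
  assume "(A', B') \<in> vclass G A B" "(C', D') \<in> vclass G C D"
  then have A': "finite_gset G A'" "finite_gset G B'" and C': "finite_gset G C'" "finite_gset G D'"
    and eq: "\<And>K. subgroup K G \<Longrightarrow> diff_mark A' B' K = diff_mark A B K"
      "\<And>K. subgroup K G \<Longrightarrow> diff_mark C' D' K = diff_mark C D K"
    using mem_vclass_iff[OF A] mem_vclass_iff[OF C] by auto
  show "vclass G (gset_sum (gset_prod A' C') (gset_prod B' D')) (gset_sum (gset_prod A' D') (gset_prod B' C')) =
    vclass G (gset_sum (gset_prod A C) (gset_prod B D)) (gset_sum (gset_prod A D) (gset_prod B C))"
    by (rule vclass_eqI)
      (simp_all only: diff_mark_mult[OF A C] diff_mark_mult[OF A' C'] eq,
        (intro finite_gset_sum finite_gset_prod A C A' C')+)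
qed

lemma burnside_add_closed:
  assumes "x \<in> carrier (burnside_ring G)" "y \<in> carrier (burnside_ring G)"
  shows "x \<oplus>\<^bsub>burnside_ring G\<^esub> y \<in> carrier (burnside_ring G)"
proof -
  obtain A B :: "('a, nat) gset" where AB: "finite_gset G A" "finite_gset G B" "x = vclass G A B"
    using burnside_ring_carrierE[OF assms(1)] .
  obtain C D :: "('a, nat) gset" where CD: "finite_gset G C" "finite_gset G D" "y = vclass G C D"
    using burnside_ring_carrierE[OF assms(2)] .
  show ?thesis
    unfolding AB(3) CD(3) burnside_add_vclass[OF AB(1,2) CD(1,2)]
    by (intro vclass_in_carrier finite_gset_sum AB CD)
qed

lemma virtual_mark_add:
  assumes "x \<in> carrier (burnside_ring G)" "y \<in> carrier (burnside_ring G)" and K: "subgroup K G"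
  shows "virtual_mark (x \<oplus>\<^bsub>burnside_ring G\<^esub> y) K = virtual_mark x K + virtual_mark y K"
proof -
  obtain A B :: "('a, nat) gset" where AB: "finite_gset G A" "finite_gset G B" "x = vclass G A B"
    using burnside_ring_carrierE[OF assms(1)] .
  obtain C D :: "('a, nat) gset" where CD: "finite_gset G C" "finite_gset G D" "y = vclass G C D"
    using burnside_ring_carrierE[OF assms(2)] .
  show ?thesis
    unfolding AB(3) CD(3) burnside_add_vclass[OF AB(1,2) CD(1,2)] virtual_mark_vclass[OF AB(1,2) K]
      virtual_mark_vclass[OF CD(1,2) K]
      virtual_mark_vclass[OF finite_gset_sum[OF AB(1) CD(1)] finite_gset_sum[OF AB(2) CD(2)] K]
    by (simp add: diff_mark_def mark_gset_sum finite_gset_finite[OF AB(1)] finite_gset_finite[OF AB(2)]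
          finite_gset_finite[OF CD(1)] finite_gset_finite[OF CD(2)])
qed

lemma virtual_mark_mult:
  assumes "x \<in> carrier (burnside_ring G)" "y \<in> carrier (burnside_ring G)" and K: "subgroup K G"
  shows "x \<otimes>\<^bsub>burnside_ring G\<^esub> y \<in> carrier (burnside_ring G)"
    and "virtual_mark (x \<otimes>\<^bsub>burnside_ring G\<^esub> y) K = virtual_mark x K * virtual_mark y K"
proof -
  obtain A B :: "('a, nat) gset" where AB: "finite_gset G A" "finite_gset G B" "x = vclass G A B"
    using burnside_ring_carrierE[OF assms(1)] .
  obtain C D :: "('a, nat) gset" where CD: "finite_gset G C" "finite_gset G D" "y = vclass G C D"
    using burnside_ring_carrierE[OF assms(2)] .
  have fin: "finite_gset G (gset_sum (gset_prod A C) (gset_prod B D))"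
    "finite_gset G (gset_sum (gset_prod A D) (gset_prod B C))"
    by (intro finite_gset_sum finite_gset_prod AB CD)+
  show "x \<otimes>\<^bsub>burnside_ring G\<^esub> y \<in> carrier (burnside_ring G)"
    unfolding AB(3) CD(3) burnside_mult_vclass[OF AB(1,2) CD(1,2)] by (rule vclass_in_carrier[OF fin])
  show "virtual_mark (x \<otimes>\<^bsub>burnside_ring G\<^esub> y) K = virtual_mark x K * virtual_mark y K"
    unfolding AB(3) CD(3) burnside_mult_vclass[OF AB(1,2) CD(1,2)] virtual_mark_vclass[OF AB(1,2) K]
      virtual_mark_vclass[OF CD(1,2) K] virtual_mark_vclass[OF fin K] diff_mark_mult[OF AB(1,2) CD(1,2)] ..
qed

lemma burnside_zero:
  shows "\<zero>\<^bsub>burnside_ring G\<^esub> \<in> carrier (burnside_ring G)"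
    and "subgroup K G \<Longrightarrow> virtual_mark \<zero>\<^bsub>burnside_ring G\<^esub> K = 0"
proof -
  have fin: "finite_gset G (trivial_gset ({} :: nat set))"
    by (rule finite_gset_trivial) simp
  have zero: "\<zero>\<^bsub>burnside_ring G\<^esub> = vclass G (trivial_gset ({} :: nat set)) (trivial_gset ({} :: nat set))"
    by (simp add: burnside_ring_def)
  show "\<zero>\<^bsub>burnside_ring G\<^esub> \<in> carrier (burnside_ring G)"
    unfolding zero by (rule vclass_in_carrier[OF fin fin])
  show "subgroup K G \<Longrightarrow> virtual_mark \<zero>\<^bsub>burnside_ring G\<^esub> K = 0"
    unfolding zero by (simp add: virtual_mark_vclass[OF fin fin] diff_mark_def)
qed

lemma burnside_one:
  shows "\<one>\<^bsub>burnside_ring G\<^esub> \<in> carrier (burnside_ring G)"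
    and "subgroup K G \<Longrightarrow> virtual_mark \<one>\<^bsub>burnside_ring G\<^esub> K = 1"
proof -
  have fin: "finite_gset G (trivial_gset {0 :: nat})" "finite_gset G (trivial_gset ({} :: nat set))"
    by (rule finite_gset_trivial, simp)+
  have one: "\<one>\<^bsub>burnside_ring G\<^esub> = vclass G (trivial_gset {0 :: nat}) (trivial_gset ({} :: nat set))"
    by (simp add: burnside_ring_def)
  show "\<one>\<^bsub>burnside_ring G\<^esub> \<in> carrier (burnside_ring G)"
    unfolding one by (rule vclass_in_carrier[OF fin])
  show "subgroup K G \<Longrightarrow> virtual_mark \<one>\<^bsub>burnside_ring G\<^esub> K = 1"
    unfolding one by (simp add: virtual_mark_vclass[OF fin] diff_mark_def mark_trivial_gset)
qed

lemma burnside_ring_abelian_group: "abelian_group (burnside_ring G)"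
proof (rule abelian_groupI)
  note add = burnside_add_closed virtual_mark_add burnside_zero
  fix x y z
  assume x: "x \<in> carrier (burnside_ring G)" and y: "y \<in> carrier (burnside_ring G)"
    and z: "z \<in> carrier (burnside_ring G)"
  show "x \<oplus>\<^bsub>burnside_ring G\<^esub> y \<oplus>\<^bsub>burnside_ring G\<^esub> z =
      x \<oplus>\<^bsub>burnside_ring G\<^esub> (y \<oplus>\<^bsub>burnside_ring G\<^esub> z)"
    by (rule burnside_ring_eqI) (simp_all add: add x y z)
next
  note add = burnside_add_closed virtual_mark_add burnside_zero
  fix x y
  assume x: "x \<in> carrier (burnside_ring G)" and y: "y \<in> carrier (burnside_ring G)"
  show "x \<oplus>\<^bsub>burnside_ring G\<^esub> y = y \<oplus>\<^bsub>burnside_ring G\<^esub> x"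
    by (rule burnside_ring_eqI) (simp_all add: add x y)
next
  note add = burnside_add_closed virtual_mark_add burnside_zero
  fix x
  assume x: "x \<in> carrier (burnside_ring G)"
  show "\<zero>\<^bsub>burnside_ring G\<^esub> \<oplus>\<^bsub>burnside_ring G\<^esub> x = x"
    by (rule burnside_ring_eqI) (simp_all add: add x)
  obtain A B :: "('a, nat) gset" where AB: "finite_gset G A" "finite_gset G B" "x = vclass G A B"
    using burnside_ring_carrierE[OF x] .
  \<comment> \<open>Exchanging the two components changes the sign of every mark, hence gives the
    negative.\<close>
  have neg: "vclass G B A \<in> carrier (burnside_ring G)"
    by (rule vclass_in_carrier[OF AB(2,1)])
  have "vclass G B A \<oplus>\<^bsub>burnside_ring G\<^esub> x = \<zero>\<^bsub>burnside_ring G\<^esub>"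
    by (rule burnside_ring_eqI)
      (use x AB(3) in \<open>simp_all add: add neg virtual_mark_vclass[OF AB(1,2)]
        virtual_mark_vclass[OF AB(2,1)] diff_mark_def\<close>)
  then show "\<exists>y\<in>carrier (burnside_ring G). y \<oplus>\<^bsub>burnside_ring G\<^esub> x = \<zero>\<^bsub>burnside_ring G\<^esub>"
    using neg by blast
qed (rule burnside_add_closed burnside_zero; assumption?)+

lemma virtual_mark_finsum:
  assumes "finite I" and f: "\<And>i. i \<in> I \<Longrightarrow> f i \<in> carrier (burnside_ring G)" and K: "subgroup K G"
  shows "virtual_mark (\<Oplus>\<^bsub>burnside_ring G\<^esub>i\<in>I. f i) K = (\<Sum>i\<in>I. virtual_mark (f i) K)"
proof -
  interpret B: abelian_group "burnside_ring G"
    by (rule burnside_ring_abelian_group)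
  show ?thesis
    using assms(1) f
  proof (induction I rule: finite_induct)
    case empty
    then show ?case
      by (simp add: burnside_zero(2)[OF K])
  next
    case (insert i I)
    then have fI: "f \<in> I \<rightarrow> carrier (burnside_ring G)" and fi: "f i \<in> carrier (burnside_ring G)"
      by auto
    show ?case
      unfolding B.finsum_insert[OF insert.hyps fI fi] virtual_mark_add[OF fi B.finsum_closed[OF fI] K]
      using insert by simp
  qed
qed

lemma virtual_mark_add_pow:
  assumes x: "x \<in> carrier (burnside_ring G)" and K: "subgroup K G"
  shows "virtual_mark ([(n :: int)] \<cdot>\<^bsub>burnside_ring G\<^esub> x) K = n * virtual_mark x K"
proof -
  interpret B: abelian_group "burnside_ring G"
    by (rule burnside_ring_abelian_group)
  have nat: "virtual_mark ([m] \<cdot>\<^bsub>burnside_ring G\<^esub> x) K = int m * virtual_mark x K" for m :: nat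
  proof (induction m)
    case 0
    then show ?case
      by (simp add: burnside_zero(2)[OF K])
  next
    case (Suc m)
    then show ?case
      using virtual_mark_add[OF B.add.nat_pow_closed[OF x] x K]
      by (simp add: distrib_right)
  qed
  show ?thesis
  proof (cases "n \<ge> 0")
    case True
    then show ?thesis
      using nat[of "nat n"] by (simp add: add_pow_int_ge)
  next
    case False
    let ?y = "[nat (- n)] \<cdot>\<^bsub>burnside_ring G\<^esub> x"
    have y: "?y \<in> carrier (burnside_ring G)"
      by (rule B.add.nat_pow_closed[OF x])
    have "virtual_mark (\<ominus>\<^bsub>burnside_ring G\<^esub> ?y) K + virtual_mark ?y K = 0"
      using virtual_mark_add[OF B.a_inv_closed[OF y] y K] B.l_neg[OF y] burnside_zero(2)[OF K] by simp
    then show ?thesis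
      using nat[of "nat (- n)"] False by (simp add: add_pow_int_lt)
  qed
qed

section \<open>Coefficients in the basis of coset spaces\<close>

lemma burnside_coset:
  assumes H: "subgroup H G"
  shows "burnside_coset G H \<in> carrier (burnside_ring G)"
    and "subgroup K G \<Longrightarrow> virtual_mark (burnside_coset G H) K = int (mark (coset_gset G H) K)"
proof -
  note fin = finite_gset_coset[OF finite_carrier H] finite_gset_trivial[of "{} :: nat set", OF finite.emptyI]
  show "burnside_coset G H \<in> carrier (burnside_ring G)"
    unfolding burnside_coset_def by (rule vclass_in_carrier[OF fin])
  show "subgroup K G \<Longrightarrow> virtual_mark (burnside_coset G H) K = int (mark (coset_gset G H) K)"
    unfolding burnside_coset_def by (simp add: virtual_mark_vclass[OF fin] diff_mark_def mark_trivial_gset)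
qed

text \<open>Replaces the condition under the \<open>THE\<close> of \<open>burnside_coeff\<close> by
  integer linear equations, with the table of marks as matrix.\<close>

lemma burnside_expansion_iff:
  assumes x: "x \<in> carrier (burnside_ring G)"
  shows "x = (\<Oplus>\<^bsub>burnside_ring G\<^esub>C\<in>subgroup_classes G.
        [(a C :: int)] \<cdot>\<^bsub>burnside_ring G\<^esub> burnside_coset G (SOME H. H \<in> C)) \<longleftrightarrow>
    (\<forall>K. subgroup K G \<longrightarrow> virtual_mark x K =
      (\<Sum>C\<in>subgroup_classes G. a C * int (mark (coset_gset G (SOME H. H \<in> C)) K)))"
proof -
  interpret B: abelian_group "burnside_ring G"
    by (rule burnside_ring_abelian_group)
  let ?f = "\<lambda>C. [a C] \<cdot>\<^bsub>burnside_ring G\<^esub> burnside_coset G (SOME H. H \<in> C)"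
  note R = subgroup_classes_some(1)[OF finite_carrier]
  have f: "?f C \<in> carrier (burnside_ring G)" if "C \<in> subgroup_classes G" for C
    by (rule B.add.int_pow_closed[OF burnside_coset(1)[OF R[OF that]]])
  have sum: "(\<Oplus>\<^bsub>burnside_ring G\<^esub>C\<in>subgroup_classes G. ?f C) \<in> carrier (burnside_ring G)"
    by (rule B.finsum_closed) (use f in auto)
  have mk: "virtual_mark (\<Oplus>\<^bsub>burnside_ring G\<^esub>C\<in>subgroup_classes G. ?f C) K =
      (\<Sum>C\<in>subgroup_classes G. a C * int (mark (coset_gset G (SOME H. H \<in> C)) K))"
    if K: "subgroup K G" for K
  proof (rule trans[OF virtual_mark_finsum[OF finite_subgroup_classes[OF finite_carrier] _ K] sum.cong[OF refl]])
    show "?f C \<in> carrier (burnside_ring G)" if "C \<in> subgroup_classes G" for C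
      by (rule f[OF that])
  next
    fix C assume C: "C \<in> subgroup_classes G"
    show "virtual_mark (?f C) K = a C * int (mark (coset_gset G (SOME H. H \<in> C)) K)"
      unfolding virtual_mark_add_pow[OF burnside_coset(1)[OF R[OF C]] K] burnside_coset(2)[OF R[OF C] K] ..
  qed
  show ?thesis
    using burnside_ring_eqI[OF x sum] mk by auto
qed

text \<open>Two solutions differ by a relation among the marks of coset spaces, which
  \<open>marks_independent\<close> makes trivial; off the index set both vanish.\<close>

lemma burnside_coeff_eqI:
  assumes x: "x \<in> carrier (burnside_ring G)"
    and off: "\<And>C. C \<notin> subgroup_classes G \<Longrightarrow> a C = 0"
    and eq: "\<And>K. subgroup K G \<Longrightarrow> virtual_mark x K =
      (\<Sum>C\<in>subgroup_classes G. a C * int (mark (coset_gset G (SOME H. H \<in> C)) K))"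
  shows "burnside_coeff G x = a"
  unfolding burnside_coeff_def burnside_expansion_iff[OF x]
proof (rule the_equality)
  fix b :: "'a set set \<Rightarrow> int"
  assume b: "(\<forall>C. C \<notin> subgroup_classes G \<longrightarrow> b C = 0) \<and> (\<forall>K. subgroup K G \<longrightarrow> virtual_mark x K =
      (\<Sum>C\<in>subgroup_classes G. b C * int (mark (coset_gset G (SOME H. H \<in> C)) K)))"
  have "(\<Sum>C\<in>subgroup_classes G. (b C - a C) * int (mark (coset_gset G (SOME H. H \<in> C)) K)) = 0"
    if K: "subgroup K G" for K
    using b[THEN conjunct2, rule_format, OF K] eq[OF K] by (simp add: left_diff_distrib sum_subtractf)
  then have "b C - a C = 0" if "C \<in> subgroup_classes G" for C
    using marks_independent[OF finite_carrier _ that, of "\<lambda>C. b C - a C"] by blast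
  then have "b C = a C" for C
    using b off by (cases "C \<in> subgroup_classes G") auto
  then show "b = a"
    by blast
qed (use off eq in blast)

lemma burnside_coeff_expansion:
  assumes x: "x \<in> carrier (burnside_ring G)" and K: "subgroup K G"
  shows "virtual_mark x K =
    (\<Sum>C\<in>subgroup_classes G. burnside_coeff G x C * int (mark (coset_gset G (SOME H. H \<in> C)) K))"
proof -
  obtain A B :: "('a, nat) gset" where AB: "finite_gset G A" "finite_gset G B" "x = vclass G A B"
    using burnside_ring_carrierE[OF x] .
  let ?m = "\<lambda>C K. int (mark (coset_gset G (SOME H. H \<in> C)) K)"
  obtain a :: "'a set set \<Rightarrow> int" where a: "\<And>K. subgroup K G \<Longrightarrow>
      int (mark A K) = (\<Sum>C\<in>subgroup_classes G. a C * ?m C K)"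
    using mark_decomposition[OF finite_carrier AB(1)] by blast
  obtain b :: "'a set set \<Rightarrow> int" where b: "\<And>K. subgroup K G \<Longrightarrow>
      int (mark B K) = (\<Sum>C\<in>subgroup_classes G. b C * ?m C K)"
    using mark_decomposition[OF finite_carrier AB(2)] by blast
  \<comment> \<open>The value 0 off the index set is part of what the \<open>THE\<close>
    demands.\<close>
  define c where "c C = (if C \<in> subgroup_classes G then a C - b C else 0)" for C
  have c: "virtual_mark x K = (\<Sum>C\<in>subgroup_classes G. c C * ?m C K)" if K: "subgroup K G" for K
    by (simp add: AB(3) virtual_mark_vclass[OF AB(1,2) K] diff_mark_def a[OF K] b[OF K] c_def
        left_diff_distrib sum_subtractf)
  have "burnside_coeff G x = c"
    by (rule burnside_coeff_eqI[OF x _ c]) (simp_all add: c_def)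
  then show ?thesis
    using c[OF K] by simp
qed

text \<open>Several \<open>H i\<close> may be conjugate, so the coefficient at a class collects all
  \<open>b i\<close> belonging to it. The core is constant on a class, so regrouping by classes
  respects the selection of those with core \<open>M\<close>.\<close>

lemma core_coeff_eq_sum:
  fixes b :: "'i \<Rightarrow> int"
  assumes y: "y \<in> carrier (burnside_ring G)" and I: "finite I"
    and H: "\<And>i. i \<in> I \<Longrightarrow> subgroup (H i) G"
    and eq: "\<And>K. subgroup K G \<Longrightarrow> virtual_mark y K = (\<Sum>i\<in>I. b i * int (mark (coset_gset G (H i)) K))"
  shows "core_coeff G M y = (\<Sum>i | i \<in> I \<and> normal_core G (H i) = M. b i)"
proof -
  define R :: "'a set set \<Rightarrow> 'a set" where "R C = (SOME H. H \<in> C)" for C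
  note R = subgroup_classes_some[OF finite_carrier, folded R_def]
  note fin = finite_subgroup_classes[OF finite_carrier]
  let ?c = "\<lambda>i. conj_class G (H i)"
  have c: "?c i \<in> subgroup_classes G" if "i \<in> I" for i
    using H[OF that] by (auto simp: subgroup_classes_def)
  have RH: "R (?c i) \<in> ?c i" if "i \<in> I" for i
    unfolding R_def by (rule someI[of "\<lambda>K. K \<in> ?c i", OF conj_class_self[OF H[OF that]]])
  have mark_R: "mark (coset_gset G (R (?c i))) K = mark (coset_gset G (H i)) K"
    if "i \<in> I" and K: "subgroup K G" for i K
    using mark_gset_iso[OF finite_gset_coset[OF finite_carrier H[OF that(1)]]
        coset_gset_conj_iso[OF finite_carrier H[OF that(1)] RH[OF that(1)]] subgroup.subset[OF K]]
    by simp
  have core_R: "normal_core G (R (?c i)) = normal_core G (H i)" if "i \<in> I" for i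
    unfolding normal_core_eq_Inter conj_class_eq[OF finite_carrier H[OF that] RH[OF that]] ..
  define a where "a C = (\<Sum>i | i \<in> I \<and> ?c i = C. b i)" for C
  have "burnside_coeff G y = a"
  proof (rule burnside_coeff_eqI[OF y])
    fix C assume "C \<notin> subgroup_classes G"
    then have "{i. i \<in> I \<and> ?c i = C} = {}"
      using c by blast
    then show "a C = 0"
      unfolding a_def by (simp only: sum.empty)
  next
    fix K assume K: "subgroup K G"
    have "(\<Sum>C\<in>subgroup_classes G. a C * int (mark (coset_gset G (R C)) K)) =
        (\<Sum>C\<in>subgroup_classes G. \<Sum>i | i \<in> I \<and> ?c i = C. b i * int (mark (coset_gset G (H i)) K))"
      unfolding a_def sum_distrib_right
      by (intro sum.cong refl) (use mark_R[OF _ K] in auto)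
    also have "\<dots> = (\<Sum>i\<in>I. b i * int (mark (coset_gset G (H i)) K))"
      by (rule sum.group[OF I fin]) (use c in blast)
    finally show "virtual_mark y K =
        (\<Sum>C\<in>subgroup_classes G. a C * int (mark (coset_gset G (SOME H. H \<in> C)) K))"
      using eq[OF K] by (simp add: R_def)
  qed
  then have "core_coeff G M y = (\<Sum>C | C \<in> subgroup_classes G \<and> normal_core G (R C) = M. a C)"
    by (simp add: core_coeff_def R_def)
  also have "\<dots> = (\<Sum>C | C \<in> subgroup_classes G \<and> normal_core G (R C) = M.
      \<Sum>i | i \<in> {i. i \<in> I \<and> normal_core G (H i) = M} \<and> ?c i = C. b i)"
    unfolding a_def by (intro sum.cong refl) (use core_R in auto)
  also have "\<dots> = (\<Sum>i | i \<in> I \<and> normal_core G (H i) = M. b i)"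
    by (rule sum.group) (use I fin c core_R in auto)
  finally show ?thesis .
qed

text \<open>In this form invertibility visibly passes along any map that acts on marks by
  composition with a map of subgroups.\<close>

lemma burnside_Units_iff:
  "u \<in> Units (burnside_ring G) \<longleftrightarrow> u \<in> carrier (burnside_ring G) \<and>
    (\<exists>v\<in>carrier (burnside_ring G). \<forall>K. subgroup K G \<longrightarrow> virtual_mark u K * virtual_mark v K = 1)"
proof -
  have "(v \<otimes>\<^bsub>burnside_ring G\<^esub> u = \<one>\<^bsub>burnside_ring G\<^esub> \<and> u \<otimes>\<^bsub>burnside_ring G\<^esub> v = \<one>\<^bsub>burnside_ring G\<^esub>)
      \<longleftrightarrow> (\<forall>K. subgroup K G \<longrightarrow> virtual_mark u K * virtual_mark v K = 1)"
    if u: "u \<in> carrier (burnside_ring G)" and v: "v \<in> carrier (burnside_ring G)" for v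
  proof
    assume "v \<otimes>\<^bsub>burnside_ring G\<^esub> u = \<one>\<^bsub>burnside_ring G\<^esub> \<and> u \<otimes>\<^bsub>burnside_ring G\<^esub> v = \<one>\<^bsub>burnside_ring G\<^esub>"
    then show "\<forall>K. subgroup K G \<longrightarrow> virtual_mark u K * virtual_mark v K = 1"
      using virtual_mark_mult(2)[OF u v] burnside_one(2) by metis
  next
    assume "\<forall>K. subgroup K G \<longrightarrow> virtual_mark u K * virtual_mark v K = 1"
    then show "v \<otimes>\<^bsub>burnside_ring G\<^esub> u = \<one>\<^bsub>burnside_ring G\<^esub> \<and> u \<otimes>\<^bsub>burnside_ring G\<^esub> v = \<one>\<^bsub>burnside_ring G\<^esub>"
      \<comment> \<open>\<open>triv_subgroup\<close> supplies the subgroup that the closure part of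
        \<open>virtual_mark_mult\<close> asks for.\<close>
      using virtual_mark_mult[OF u v] virtual_mark_mult[OF v u] burnside_one triv_subgroup
      by (intro conjI burnside_ring_eqI) (auto simp: mult.commute)
  qed
  then show ?thesis
    unfolding Units_def by blast
qed

end

section \<open>Core coefficients under fixed points and inflation\<close>

lemma finite_group_FactGroup:
  assumes "finite_group G" and N: "N \<lhd> G"
  shows "finite_group (G Mod N)"
proof -
  interpret finite_group G
    by fact
  interpret Q: group "G Mod N"
    by (rule normal.factorgroup_is_group[OF N])
  show ?thesis
    by unfold_locales (simp add: carrier_FactGroup finite_carrier)
qed

text \<open>An element and its inverse are both moved along \<open>\<phi>\<close>, and their marks
  still multiply to 1. It is used with preimages for fixed points and, with the two groups
  exchanged, with images for inflation.\<close>

lemma Units_burnside_ring_transfer: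
  assumes G: "finite_group G" and Q: "finite_group Q"
    and sub: "\<And>K. subgroup K Q \<Longrightarrow> subgroup (\<phi> K) G"
    and ex: "\<And>x. x \<in> carrier (burnside_ring G) \<Longrightarrow>
      \<exists>y\<in>carrier (burnside_ring Q). \<forall>K. subgroup K Q \<longrightarrow> virtual_mark y K = virtual_mark x (\<phi> K)"
    and u: "u \<in> Units (burnside_ring G)"
  shows "\<exists>y\<in>Units (burnside_ring Q). \<forall>K. subgroup K Q \<longrightarrow> virtual_mark y K = virtual_mark u (\<phi> K)"
proof -
  obtain v where v: "v \<in> carrier (burnside_ring G)"
    and uv: "\<And>K. subgroup K G \<Longrightarrow> virtual_mark u K * virtual_mark v K = 1"
    and uG: "u \<in> carrier (burnside_ring G)"
    using u finite_group.burnside_Units_iff[OF G] by blast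
  obtain y where y: "y \<in> carrier (burnside_ring Q)"
    "\<And>K. subgroup K Q \<Longrightarrow> virtual_mark y K = virtual_mark u (\<phi> K)"
    using ex[OF uG] by blast
  obtain z where z: "z \<in> carrier (burnside_ring Q)"
    "\<And>K. subgroup K Q \<Longrightarrow> virtual_mark z K = virtual_mark v (\<phi> K)"
    using ex[OF v] by blast
  have "virtual_mark y K * virtual_mark z K = 1" if "subgroup K Q" for K
    using y(2)[OF that] z(2)[OF that] uv[OF sub[OF that]] by simp
  then have "y \<in> Units (burnside_ring Q)"
    using finite_group.burnside_Units_iff[OF Q] y(1) z(1) by blast
  then show ?thesis
    using y(2) by blast
qed

lemma ex_burnside_fixed_points:
  assumes G: "finite_group G" and N: "N \<lhd> G" and x: "x \<in> carrier (burnside_ring G)"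
  shows "\<exists>y\<in>carrier (burnside_ring (G Mod N)).
    \<forall>K. subgroup K (G Mod N) \<longrightarrow> virtual_mark y K = virtual_mark x (\<Union>K)"
proof -
  note Q = finite_group_FactGroup[OF G N]
  obtain A B :: "('a, nat) gset" where AB: "finite_gset G A" "finite_gset G B" "x = vclass G A B"
    using finite_group.burnside_ring_carrierE[OF G x] .
  note fin = finite_gset_fixed[OF N AB(1)] finite_gset_fixed[OF N AB(2)]
  let ?y = "vclass (G Mod N) (fixed_gset G N A) (fixed_gset G N B)"
  have "virtual_mark ?y K = virtual_mark x (\<Union>K)" if K: "subgroup K (G Mod N)" for K
    unfolding finite_group.virtual_mark_vclass[OF Q fin K] AB(3)
      finite_group.virtual_mark_vclass[OF G AB(1,2) subgroup_Union_FactGroup[OF N K]]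
    by (simp add: diff_mark_def mark_fixed_gset[OF N AB(1) K] mark_fixed_gset[OF N AB(2) K])
  then show ?thesis
    using finite_group.vclass_in_carrier[OF Q fin] by blast
qed

lemma ex_burnside_inflation:
  assumes G: "finite_group G" and N: "N \<lhd> G" and y: "y \<in> carrier (burnside_ring (G Mod N))"
  shows "\<exists>x\<in>carrier (burnside_ring G).
    \<forall>K. subgroup K G \<longrightarrow> virtual_mark x K = virtual_mark y ((\<lambda>g. N #>\<^bsub>G\<^esub> g) ` K)"
proof -
  note Q = finite_group_FactGroup[OF G N]
  obtain A B :: "('a set, nat) gset" where AB: "finite_gset (G Mod N) A" "finite_gset (G Mod N) B"
      "y = vclass (G Mod N) A B"
    using finite_group.burnside_ring_carrierE[OF Q y] .
  note fin = finite_gset_inflate[OF N AB(1)] finite_gset_inflate[OF N AB(2)]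
  let ?x = "vclass G (inflate G N A) (inflate G N B)"
  have "virtual_mark ?x K = virtual_mark y ((\<lambda>g. N #>\<^bsub>G\<^esub> g) ` K)" if K: "subgroup K G" for K
    unfolding finite_group.virtual_mark_vclass[OF G fin K] AB(3)
      finite_group.virtual_mark_vclass[OF Q AB(1,2) subgroup_image_FactGroup[OF N K]]
    by (simp add: diff_mark_def mark_inflate)
  then show ?thesis
    using finite_group.vclass_in_carrier[OF G fin] by blast
qed

text \<open>Expanding \<open>x\<close> and evaluating at preimages writes \<open>y\<close> as a
  combination of coset spaces of the groups \<open>H/N\<close>, from which
  \<open>core_coeff_eq_sum\<close> reads off the core coefficient. As \<open>y\<close> is
  constrained only by its marks, the lemma covers both fixed points and elements that were
  inflated.\<close>

lemma core_coeff_fixed_points: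
  assumes G: "finite_group G" and N: "N \<lhd> G" and x: "x \<in> carrier (burnside_ring G)"
    and y: "y \<in> carrier (burnside_ring (G Mod N))"
    and xy: "\<And>K. subgroup K (G Mod N) \<Longrightarrow> virtual_mark y K = virtual_mark x (\<Union>K)"
  shows "core_coeff (G Mod N) {\<one>\<^bsub>G Mod N\<^esub>} y = core_coeff G N x"
proof -
  interpret finite_group G
    by (rule G)
  note Q = finite_group_FactGroup[OF G N]
  define R :: "'a set set \<Rightarrow> 'a set" where "R C = (SOME H. H \<in> C)" for C
  note R = subgroup_classes_some(1)[OF finite_carrier, folded R_def]
  note fin = finite_subgroup_classes[OF finite_carrier]
  let ?a = "burnside_coeff G x"
  let ?q = "\<lambda>H. (\<lambda>g. N #>\<^bsub>G\<^esub> g) ` H"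
  let ?I = "{C \<in> subgroup_classes G. N \<subseteq> R C}"
  have core_le: "normal_core G (R C) \<subseteq> R C" if "C \<in> subgroup_classes G" for C
    unfolding normal_core_eq_Inter by (rule Inter_lower[OF conj_class_self[OF R[OF that]]])
  have "core_coeff (G Mod N) {\<one>\<^bsub>G Mod N\<^esub>} y =
      (\<Sum>C | C \<in> ?I \<and> normal_core (G Mod N) (?q (R C)) = {\<one>\<^bsub>G Mod N\<^esub>}. ?a C)"
  proof (rule finite_group.core_coeff_eq_sum[OF Q y])
    show "finite ?I"
      using fin by simp
    show "subgroup (?q (R C)) (G Mod N)" if "C \<in> ?I" for C
      using subgroup_image_FactGroup[OF N R] that by blast
    fix K assume K: "subgroup K (G Mod N)"
    have "virtual_mark y K = (\<Sum>C\<in>subgroup_classes G. ?a C * int (mark (coset_gset G (R C)) (\<Union>K)))"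
      unfolding xy[OF K] R_def by (rule burnside_coeff_expansion[OF x subgroup_Union_FactGroup[OF N K]])
    \<comment> \<open>Coset spaces of subgroups not containing \<open>N\<close> have mark 0 at every
      preimage.\<close>
    also have "\<dots> = (\<Sum>C\<in>?I. ?a C * int (mark (coset_gset G (R C)) (\<Union>K)))"
      by (rule sum.mono_neutral_right)
        (use fin mark_coset_gset_FactGroup[OF N finite_carrier R K] in auto)
    also have "\<dots> = (\<Sum>C\<in>?I. ?a C * int (mark (coset_gset (G Mod N) (?q (R C))) K))"
      by (intro sum.cong refl) (use mark_coset_gset_FactGroup[OF N finite_carrier R K] in auto)
    finally show "virtual_mark y K = (\<Sum>C\<in>?I. ?a C * int (mark (coset_gset (G Mod N) (?q (R C))) K))" .
  qed
  also have "{C. C \<in> ?I \<and> normal_core (G Mod N) (?q (R C)) = {\<one>\<^bsub>G Mod N\<^esub>}} =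
      {C \<in> subgroup_classes G. normal_core G (R C) = N}"
  proof (rule Collect_cong)
    fix C
    show "C \<in> ?I \<and> normal_core (G Mod N) (?q (R C)) = {\<one>\<^bsub>G Mod N\<^esub>} \<longleftrightarrow>
        C \<in> subgroup_classes G \<and> normal_core G (R C) = N"
    proof (cases "C \<in> ?I")
      case True
      then show ?thesis
        using normal_core_FactGroup[OF N finite_carrier R[of C]] by blast
    next
      \<comment> \<open>A subgroup contains its core, so core \<open>N\<close> is impossible when
        \<open>N\<close> is not contained in \<open>R C\<close>.\<close>
      case False
      then show ?thesis
        using core_le[of C] by blast
    qed
  qed
  finally show ?thesis
    by (simp add: core_coeff_def R_def)
qed

theorem corollary5p2:
  fixes G :: "('a, 'm) monoid_scheme" and N :: "'a set"
  assumes "group G" and "finite (carrier G)" and "N \<lhd> G"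
  shows "{core_coeff G N u | u. u \<in> Units (burnside_ring G)} =
           {core_coeff (G Mod N) {\<one>\<^bsub>G Mod N\<^esub>} v | v. v \<in> Units (burnside_ring (G Mod N))} \<and>
         ((\<forall>u\<in>Units (burnside_ring G). core_coeff G N u = 0) \<longleftrightarrow>
          (\<forall>v\<in>Units (burnside_ring (G Mod N)). core_coeff (G Mod N) {\<one>\<^bsub>G Mod N\<^esub>} v = 0))"
proof -
  have G: "finite_group G"
    using assms(1,2) by (simp add: finite_group_def finite_group_axioms_def)
  note N = assms(3)
  note Q = finite_group_FactGroup[OF G N]
  have carrier: "u \<in> carrier (burnside_ring G)" if "u \<in> Units (burnside_ring G)" for u
    using that by (simp add: Units_def)
  have carrierQ: "v \<in> carrier (burnside_ring (G Mod N))" if "v \<in> Units (burnside_ring (G Mod N))" for v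
    using that by (simp add: Units_def)
  have fix_unit: "\<exists>v\<in>Units (burnside_ring (G Mod N)). core_coeff (G Mod N) {\<one>\<^bsub>G Mod N\<^esub>} v = core_coeff G N u"
    if u: "u \<in> Units (burnside_ring G)" for u
  proof -
    obtain v where "v \<in> Units (burnside_ring (G Mod N))"
      "\<And>K. subgroup K (G Mod N) \<Longrightarrow> virtual_mark v K = virtual_mark u (\<Union>K)"
      using Units_burnside_ring_transfer[OF G Q subgroup_Union_FactGroup[OF N]
          ex_burnside_fixed_points[OF G N] u] by blast
    then show ?thesis
      using core_coeff_fixed_points[OF G N carrier[OF u] carrierQ] by blast
  qed
  have inf_unit: "\<exists>u\<in>Units (burnside_ring G). core_coeff (G Mod N) {\<one>\<^bsub>G Mod N\<^esub>} v = core_coeff G N u"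
    if v: "v \<in> Units (burnside_ring (G Mod N))" for v
  proof -
    obtain u where u: "u \<in> Units (burnside_ring G)"
      and uv: "\<And>K. subgroup K G \<Longrightarrow> virtual_mark u K = virtual_mark v ((\<lambda>g. N #>\<^bsub>G\<^esub> g) ` K)"
      using Units_burnside_ring_transfer[OF Q G subgroup_image_FactGroup[OF N]
          ex_burnside_inflation[OF G N] v] by blast
    \<comment> \<open>Inflating and then passing to preimages evaluates \<open>v\<close> at the
      image of \<open>\<Union>K\<close>, which is \<open>K\<close>. So \<open>v\<close> has the
      marks of the fixed points of \<open>u\<close>.\<close>
    have "virtual_mark v K = virtual_mark u (\<Union>K)" if K: "subgroup K (G Mod N)" for K
      using uv[OF subgroup_Union_FactGroup[OF N K]] FactGroup_image_Union[OF N subgroup.subset[OF K]]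
      by simp
    then show ?thesis
      using core_coeff_fixed_points[OF G N carrier[OF u] carrierQ[OF v]] u by blast
  qed
  have "{core_coeff G N u | u. u \<in> Units (burnside_ring G)} =
      {core_coeff (G Mod N) {\<one>\<^bsub>G Mod N\<^esub>} v | v. v \<in> Units (burnside_ring (G Mod N))}"
    using fix_unit inf_unit by (smt (verit) Collect_cong)
  moreover from fix_unit inf_unit have "(\<forall>u\<in>Units (burnside_ring G). core_coeff G N u = 0) \<longleftrightarrow>
      (\<forall>v\<in>Units (burnside_ring (G Mod N)). core_coeff (G Mod N) {\<one>\<^bsub>G Mod N\<^esub>} v = 0)"
    by metis
  ultimately show ?thesis ..
qed

end
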